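(* Let $n\ge 1$ and let $m$ be an integer with $|m|\le n$, $m\equiv n\pmod 2$. (1) If $m\in\{0,1\}$, then $S_{(n,m)}$ spans the left ideal $b_nS_{(n,m)}$ over $k$. (2) If $m=-1$, then $S_{(n,m)}$ spans a left ideal modulo $b_nS_{(n,1)}$. (3) If $m\ge 2$, then $S_{(n,m)}$ spans a left ideal modulo $b_nE_{m-2}(n)b_n$. (4) If $m<-1$, then $S_{(n,m)}$ spans a left ideal modulo $b_nS_{(n,-m)}+b_nE_{|m|-2}(n)b_n$. Here "a set $S$ spans a left ideal modulo a left ideal $J$" means that $\mathrm{span}_k(S)+J$ is a left ideal of $b_n$.
   Context: Algebra. Let $K$ be a commutative ring with $1$, $x\in K$ invertible, $q=x^2$, and $\gamma,\delta_e\in K$. For $n\ge 1$, $b_n^K$ is the unital associative $K$-algebra with generators $e,U_1,\ldots,U_{n-1}$ and relations $U_iU_i=(q+q^{-1})U_i$; $U_iU_{i\pm1}U_i=U_i$ (whenever both indices lie in $\{1,\dots,n-1\}$); $U_iU_j=U_jU_i$ if $|i-j|\ne 1$; $U_1eU_1=\gamma U_1$; $ee=\delta_e e$; $U_ie=eU_i$ if $i\ne 1$. For $k$ a field which is a $K$-algebra, $b_n=k\otimes_K b_n^K$. For $0\le m\le n$, $m\equiv n\pmod 2$: $E_m(n)=U_1U_3\cdots U_{n-m-1}$ ($=1$ if $m=n$). $b_nS$ denotes the left ideal generated by a set $S$, and $b_nEb_n$ the two-sided ideal generated by $E$. Paths. Vertices of the Pascal triangle are pairs (level, weight) in $\mathbb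 Z_{\ge0}\times\mathbb Z$; edges join $(j,l)$ to $(j+1,l\pm1)$. $S_{n,m}$ is the set of descending walks from $(0,0)$ to $(n,m)$. Each edge is assigned a word $w(\text{edge})$: (i) $w((j,l),(j+1,l+1))=1$ if $l>0$, and $w((j,l),(j+1,l-1))=1$ if $l<0$; (ii) if $l\ne0$ and the edge goes from $(j,l)$ to $(j+1,l')$ with $|l'|=|l|-1$, then $w=U_jU_{j-1}\cdots U_1$; (iii) $w((j,0),(j+1,1))=e\,(U_jU_{j-2}\cdots U_2)(U_{j-1}U_{j-3}\cdots U_1)$ ($j$ is even; empty products are $1$, so this is $e$ for $j=0$); (iv) $w((j,0),(j+1,-1))=1$. For a walk $p$ with successive edges $p_1,\ldots,p_n$ put $w(p)=w(p_1)\cdots w(p_n)$, and $S_{(n,m)}=\{w(p):p\in S_{n,m}\}$, regarded as a set of elements of $b_n$. *)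

theory Defs
  imports "HOL-Algebra.Algebra" "HOL-Algebra.Algebraic_Closure_Type" "HOL-Library.Poly_Mapping"
begin

text \<open>
  An associative algebra with unit, not necessarily commutative, is represented by the record
  type of \<^theory>\<open>HOL-Algebra.Module\<close>: a ring record together with a scalar multiplication.
  The ground ring is a type of class \<^class>\<open>comm_ring_1\<close>.
\<close>

definition convolution ::
    "('a, 'z) monoid_scheme \<Rightarrow> ('a \<Rightarrow>\<^sub>0 'r) \<Rightarrow> ('a \<Rightarrow>\<^sub>0 'r) \<Rightarrow> ('a \<Rightarrow>\<^sub>0 'r::comm_ring_1)" where
  "convolution M f g = (\<Sum>a\<in>Poly_Mapping.keys f. \<Sum>b\<in>Poly_Mapping.keys g.
     Poly_Mapping.single (a \<otimes>\<^bsub>M\<^esub> b) (Poly_Mapping.lookup f a * Poly_Mapping.lookup g b))"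

definition monoid_algebra :: "('a, 'z) monoid_scheme \<Rightarrow> ('r::comm_ring_1, 'a \<Rightarrow>\<^sub>0 'r) module" where
  "monoid_algebra M = \<lparr>
     carrier = {f. Poly_Mapping.keys f \<subseteq> carrier M},
     monoid.mult = convolution M,
     one = Poly_Mapping.single \<one>\<^bsub>M\<^esub> 1,
     ring.zero = 0,
     add = (+),
     module.smult = (\<lambda>c. Poly_Mapping.map ((*) c))\<rparr>"

definition quotient_algebra :: "('r, 'a) module \<Rightarrow> 'a set \<Rightarrow> ('r, 'a set) module" where
  "quotient_algebra A I =
     ring.extend (A Quot I) \<lparr>module.smult = (\<lambda>c C. \<Union>a\<in>C. I +>\<^bsub>A\<^esub> (c \<odot>\<^bsub>A\<^esub> a))\<rparr>"

definition free_monoid :: "'g set \<Rightarrow> 'g list monoid" where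
  "free_monoid G = \<lparr>carrier = lists G, monoid.mult = (@), one = []\<rparr>"

definition free_algebra :: "'g set \<Rightarrow> ('r::comm_ring_1, 'g list \<Rightarrow>\<^sub>0 'r) module" where
  "free_algebra G = monoid_algebra (free_monoid G)"

definition presented_algebra ::
    "'g set \<Rightarrow> ('g list \<Rightarrow>\<^sub>0 'r) set \<Rightarrow> ('r::comm_ring_1, ('g list \<Rightarrow>\<^sub>0 'r) set) module" where
  "presented_algebra G D = quotient_algebra (free_algebra G) (Idl\<^bsub>free_algebra G\<^esub> D)"

definition presented_gen ::
    "'g set \<Rightarrow> ('g list \<Rightarrow>\<^sub>0 'r) set \<Rightarrow> 'g \<Rightarrow> ('g list \<Rightarrow>\<^sub>0 'r::comm_ring_1) set" where
  "presented_gen G D g =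
     (Idl\<^bsub>free_algebra G\<^esub> D) +>\<^bsub>free_algebra G\<^esub> Poly_Mapping.single [g] 1"

text \<open>
  Extension of scalars of an \<open>'r\<close>-algebra \<open>A\<close> along a ring homomorphism \<open>\<phi>\<close> from \<open>'r\<close> to \<open>'k\<close>,
  i.e. the tensor product of \<open>'k\<close> and \<open>A\<close> over \<open>'r\<close>: the free \<open>'k\<close>-module on the set \<open>carrier A\<close>
  modulo the relations making \<open>a \<mapsto> 1 \<otimes> a\<close> additive and \<open>\<phi>\<close>-linear. The free module carries
  the product extending that of \<open>A\<close> bilinearly, which induces the product
  \<open>(s \<otimes> a) (t \<otimes> b) = s t \<otimes> a b\<close>. The \<open>'k\<close>-submodule generated by the relations is already a
  two-sided ideal, so nothing more is identified by taking the ideal generated by them.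
\<close>

definition scalar_relations ::
    "('r \<Rightarrow> 'k) \<Rightarrow> ('r, 'a) module \<Rightarrow> ('a \<Rightarrow>\<^sub>0 'k::comm_ring_1) set" where
  "scalar_relations \<phi> A =
     {Poly_Mapping.single (a \<oplus>\<^bsub>A\<^esub> b) 1 - (Poly_Mapping.single a 1 + Poly_Mapping.single b 1) | a b.
        a \<in> carrier A \<and> b \<in> carrier A} \<union>
     {Poly_Mapping.single (c \<odot>\<^bsub>A\<^esub> a) 1 - Poly_Mapping.single a (\<phi> c) | c a. a \<in> carrier A}"

definition extend_scalars ::
    "('r \<Rightarrow> 'k) \<Rightarrow> ('r, 'a) module \<Rightarrow> ('k::comm_ring_1, ('a \<Rightarrow>\<^sub>0 'k) set) module" where
  "extend_scalars \<phi> A =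
     quotient_algebra (monoid_algebra A) (Idl\<^bsub>monoid_algebra A\<^esub> (scalar_relations \<phi> A))"

definition one_tensor ::
    "('r \<Rightarrow> 'k) \<Rightarrow> ('r, 'a) module \<Rightarrow> 'a \<Rightarrow> ('a \<Rightarrow>\<^sub>0 'k::comm_ring_1) set" where
  "one_tensor \<phi> A a =
     (Idl\<^bsub>monoid_algebra A\<^esub> (scalar_relations \<phi> A)) +>\<^bsub>monoid_algebra A\<^esub> Poly_Mapping.single a 1"

definition left_ideal :: "'a set \<Rightarrow> ('a, 'z) ring_scheme \<Rightarrow> bool" where
  "left_ideal I R \<longleftrightarrow>
     additive_subgroup I R \<and> (\<forall>a\<in>carrier R. \<forall>x\<in>I. a \<otimes>\<^bsub>R\<^esub> x \<in> I)"

definition left_ideal_gen :: "('a, 'z) ring_scheme \<Rightarrow> 'a set \<Rightarrow> 'a set" where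
  "left_ideal_gen R S = (\<lambda>I. left_ideal I R) hull S"

definition lin_span :: "('k::comm_ring_1, 'a) module \<Rightarrow> 'a set \<Rightarrow> 'a set" where
  "lin_span A S = (\<lambda>V. submodule V (ring_of_type_algebra :: 'k ring) A) hull S"

definition word_value :: "('a, 'z) monoid_scheme \<Rightarrow> ('g \<Rightarrow> 'a) \<Rightarrow> 'g list \<Rightarrow> 'a" where
  "word_value M h w = foldr (\<lambda>g y. h g \<otimes>\<^bsub>M\<^esub> y) w \<one>\<^bsub>M\<^esub>"

datatype blob_gen = E | U nat

definition blob_gens :: "nat \<Rightarrow> blob_gen set" where
  "blob_gens n = insert E (U ` {1..<n})"

text \<open>
  A relation \<open>v = c w\<close> between words \<open>v\<close>, \<open>w\<close> is given by the element
  \<open>single v 1 - single w c\<close> of the free algebra. The parameter \<open>q'\<close> is the inverse of \<open>q\<close>.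
\<close>

inductive_set blob_relations ::
    "nat \<Rightarrow> 'r \<Rightarrow> 'r \<Rightarrow> 'r \<Rightarrow> 'r \<Rightarrow> (blob_gen list \<Rightarrow>\<^sub>0 'r::comm_ring_1) set"
  for n :: nat and q q' \<gamma> \<delta> :: "'r::comm_ring_1" where
  U_square: "i \<in> {1..<n} \<Longrightarrow>
    Poly_Mapping.single [U i, U i] 1 - Poly_Mapping.single [U i] (q + q') \<in> blob_relations n q q' \<gamma> \<delta>"
| U_braid: "i \<in> {1..<n} \<Longrightarrow> j \<in> {1..<n} \<Longrightarrow> j = i + 1 \<or> i = j + 1 \<Longrightarrow>
    Poly_Mapping.single [U i, U j, U i] 1 - Poly_Mapping.single [U i] 1 \<in> blob_relations n q q' \<gamma> \<delta>"
| U_commute: "i \<in> {1..<n} \<Longrightarrow> j \<in> {1..<n} \<Longrightarrow> \<not> (j = i + 1 \<or> i = j + 1) \<Longrightarrow>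
    Poly_Mapping.single [U i, U j] 1 - Poly_Mapping.single [U j, U i] 1 \<in> blob_relations n q q' \<gamma> \<delta>"
| U_E_U: "1 \<in> {1..<n} \<Longrightarrow>
    Poly_Mapping.single [U 1, E, U 1] 1 - Poly_Mapping.single [U 1] \<gamma> \<in> blob_relations n q q' \<gamma> \<delta>"
| E_square:
    "Poly_Mapping.single [E, E] 1 - Poly_Mapping.single [E] \<delta> \<in> blob_relations n q q' \<gamma> \<delta>"
| U_E_commute: "i \<in> {1..<n} \<Longrightarrow> i \<noteq> 1 \<Longrightarrow>
    Poly_Mapping.single [U i, E] 1 - Poly_Mapping.single [E, U i] 1 \<in> blob_relations n q q' \<gamma> \<delta>"

definition blob_algebra_K ::
    "nat \<Rightarrow> 'r \<Rightarrow> 'r \<Rightarrow> 'r \<Rightarrow> 'r \<Rightarrow> ('r::comm_ring_1, (blob_gen list \<Rightarrow>\<^sub>0 'r) set) module" where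
  "blob_algebra_K n q q' \<gamma> \<delta> = presented_algebra (blob_gens n) (blob_relations n q q' \<gamma> \<delta>)"

definition blob_algebra ::
    "('r \<Rightarrow> 'k) \<Rightarrow> nat \<Rightarrow> 'r \<Rightarrow> 'r \<Rightarrow> 'r \<Rightarrow> 'r \<Rightarrow>
     ('k::field, ((blob_gen list \<Rightarrow>\<^sub>0 'r::comm_ring_1) set \<Rightarrow>\<^sub>0 'k) set) module" where
  "blob_algebra \<phi> n q q' \<gamma> \<delta> = extend_scalars \<phi> (blob_algebra_K n q q' \<gamma> \<delta>)"

definition blob_generator ::
    "('r \<Rightarrow> 'k) \<Rightarrow> nat \<Rightarrow> 'r \<Rightarrow> 'r \<Rightarrow> 'r \<Rightarrow> 'r \<Rightarrow> blob_gen \<Rightarrow>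
     ((blob_gen list \<Rightarrow>\<^sub>0 'r::comm_ring_1) set \<Rightarrow>\<^sub>0 'k::field) set" where
  "blob_generator \<phi> n q q' \<gamma> \<delta> g =
     one_tensor \<phi> (blob_algebra_K n q q' \<gamma> \<delta>)
       (presented_gen (blob_gens n) (blob_relations n q q' \<gamma> \<delta>) g)"

definition blob_word ::
    "('r \<Rightarrow> 'k) \<Rightarrow> nat \<Rightarrow> 'r \<Rightarrow> 'r \<Rightarrow> 'r \<Rightarrow> 'r \<Rightarrow> blob_gen list \<Rightarrow>
     ((blob_gen list \<Rightarrow>\<^sub>0 'r::comm_ring_1) set \<Rightarrow>\<^sub>0 'k::field) set" where
  "blob_word \<phi> n q q' \<gamma> \<delta> w =
     word_value (blob_algebra \<phi> n q q' \<gamma> \<delta>) (blob_generator \<phi> n q q' \<gamma> \<delta>) w"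

text \<open>The word \<open>U 1, U 3, \<dots>, U (n - m - 1)\<close>, for \<open>m \<le> n\<close> of the same parity as \<open>n\<close>.\<close>

definition E_word :: "nat \<Rightarrow> nat \<Rightarrow> blob_gen list" where
  "E_word m n = map (\<lambda>i. U (2 * i + 1)) [0..<(n - m) div 2]"

text \<open>A walk is the list of the weights of its successive vertices, at levels \<open>0, \<dots>, n\<close>.\<close>

definition walks :: "nat \<Rightarrow> int \<Rightarrow> int list set" where
  "walks n m = {p. length p = Suc n \<and> p ! 0 = 0 \<and> p ! n = m \<and>
                   (\<forall>j<n. p ! Suc j = p ! j + 1 \<or> p ! Suc j = p ! j - 1)}"

text \<open>
  The word of the edge from \<open>(j, l)\<close> to \<open>(j + 1, l')\<close>. The second branch is
  \<open>e (U j, U (j - 2), \<dots>, U 2) (U (j - 1), U (j - 3), \<dots>, U 1)\<close>, where \<open>j\<close> is even as \<open>l = 0\<close>.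
  The last branch is reached by the edges away from weight 0 and by those from weight 0 to -1.
\<close>

definition edge_word :: "nat \<Rightarrow> int \<Rightarrow> int \<Rightarrow> blob_gen list" where
  "edge_word j l l' =
     (if l \<noteq> 0 \<and> \<bar>l'\<bar> = \<bar>l\<bar> - 1 then map U (rev [1..<Suc j])
      else if l = 0 \<and> l' = 1 then
        E # map (\<lambda>i. U (2 * i)) (rev [1..<Suc (j div 2)])
          @ map (\<lambda>i. U (2 * i - 1)) (rev [1..<Suc (j div 2)])
      else [])"

definition walk_word :: "nat \<Rightarrow> int list \<Rightarrow> blob_gen list" where
  "walk_word n p = concat (map (\<lambda>j. edge_word j (p ! j) (p ! Suc j)) [0..<n])"

definition walk_elements ::
    "('r \<Rightarrow> 'k) \<Rightarrow> nat \<Rightarrow> 'r \<Rightarrow> 'r \<Rightarrow> 'r \<Rightarrow> 'r \<Rightarrow> int \<Rightarrow>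
     ((blob_gen list \<Rightarrow>\<^sub>0 'r::comm_ring_1) set \<Rightarrow>\<^sub>0 'k::field) set set" where
  "walk_elements \<phi> n q q' \<gamma> \<delta> m =
     {blob_word \<phi> n q q' \<gamma> \<delta> (walk_word n p) | p. p \<in> walks n m}"

lemma lookup_smult: "Poly_Mapping.lookup (Poly_Mapping.map ((*) (c::'r::comm_ring_1)) f) a = c * Poly_Mapping.lookup f a"
  by (simp add: Poly_Mapping.map.rep_eq when_def)

lemma convolution_superset:
  fixes f g :: "'a \<Rightarrow>\<^sub>0 'r::comm_ring_1"
  assumes "finite P" "finite Q" "Poly_Mapping.keys f \<subseteq> P" "Poly_Mapping.keys g \<subseteq> Q"
  shows "convolution M f g = (\<Sum>a\<in>P. \<Sum>b\<in>Q. Poly_Mapping.single (a \<otimes>\<^bsub>M\<^esub> b) (Poly_Mapping.lookup f a * Poly_Mapping.lookup g b))"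
proof -
  have "convolution M f g = (\<Sum>a\<in>P. \<Sum>b\<in>Poly_Mapping.keys g. Poly_Mapping.single (a \<otimes>\<^bsub>M\<^esub> b) (Poly_Mapping.lookup f a * Poly_Mapping.lookup g b))"
    unfolding convolution_def by (rule sum.mono_neutral_left) (use assms in \<open>auto simp: in_keys_iff\<close>)
  also have "\<dots> = (\<Sum>a\<in>P. \<Sum>b\<in>Q. Poly_Mapping.single (a \<otimes>\<^bsub>M\<^esub> b) (Poly_Mapping.lookup f a * Poly_Mapping.lookup g b))"
    by (rule sum.cong[OF refl], rule sum.mono_neutral_left) (use assms in \<open>auto simp: in_keys_iff\<close>)
  finally show ?thesis .
qed

lemma convolution_add_left: fixes f g h :: "'a \<Rightarrow>\<^sub>0 'r::comm_ring_1"
  shows "convolution M (f + g) h = convolution M f h + convolution M g h"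
proof -
  let ?P = "Poly_Mapping.keys f \<union> Poly_Mapping.keys g" and ?Q = "Poly_Mapping.keys h"
  have "Poly_Mapping.keys (f+g) \<subseteq> ?P" by (rule Poly_Mapping.keys_add)
  then show ?thesis
    by (simp add: convolution_superset[of ?P ?Q "f+g" h M] convolution_superset[of ?P ?Q f h M] convolution_superset[of ?P ?Q g h M] lookup_add distrib_right single_add sum.distrib)
qed

lemma convolution_add_right: fixes f g h :: "'a \<Rightarrow>\<^sub>0 'r::comm_ring_1"
  shows "convolution M h (f + g) = convolution M h f + convolution M h g"
proof -
  let ?P = "Poly_Mapping.keys f \<union> Poly_Mapping.keys g" and ?Q = "Poly_Mapping.keys h"
  have "Poly_Mapping.keys (f+g) \<subseteq> ?P" by (rule Poly_Mapping.keys_add)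
  then show ?thesis
    by (simp add: convolution_superset[of ?Q ?P h "f+g" M] convolution_superset[of ?Q ?P h f M] convolution_superset[of ?Q ?P h g M] lookup_add distrib_left single_add sum.distrib)
qed

lemma convolution_single: "convolution M (Poly_Mapping.single a (s::'r::comm_ring_1)) (Poly_Mapping.single b t) = Poly_Mapping.single (a \<otimes>\<^bsub>M\<^esub> b) (s * t)"
  by (subst convolution_superset[of "{a}" "{b}"]) auto

lemma convolution_sum_left: "convolution M (\<Sum>i\<in>I. F i) h = (\<Sum>i\<in>I. convolution M (F i) h)"
proof (induction I rule: infinite_finite_induct)
  case (insert i I) then show ?case by (simp add: convolution_add_left)
qed (auto simp: convolution_def)
lemma convolution_sum_right: "convolution M h (\<Sum>i\<in>I. F i) = (\<Sum>i\<in>I. convolution M h (F i))"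
proof (induction I rule: infinite_finite_induct)
  case (insert i I) then show ?case by (simp add: convolution_add_right)
qed (auto simp: convolution_def)

lemma poly_mapping_decomp: "f = (\<Sum>a\<in>Poly_Mapping.keys f. Poly_Mapping.single a (Poly_Mapping.lookup f a))"
  by (rule poly_mapping_eqI) (auto simp: lookup_sum lookup_single when_def sum.delta in_keys_iff)

lemma convolution_carrier: assumes "monoid M" "Poly_Mapping.keys f \<subseteq> carrier M" "Poly_Mapping.keys g \<subseteq> carrier M"
  shows "Poly_Mapping.keys (convolution M f (g::'a \<Rightarrow>\<^sub>0 'r::comm_ring_1)) \<subseteq> carrier M"
proof -
  interpret monoid M by fact
  show ?thesis unfolding convolution_def
    apply (rule order_trans[OF Poly_Mapping.keys_sum] UN_least order_trans[OF Poly_Mapping.keys_sum])+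
    using assms by (auto split: if_splits)
qed

lemma convolution_assoc: assumes "monoid M" "Poly_Mapping.keys f \<subseteq> carrier M" "Poly_Mapping.keys g \<subseteq> carrier M" "Poly_Mapping.keys h \<subseteq> carrier M"
  shows "convolution M (convolution M f g) (h::'a \<Rightarrow>\<^sub>0 'r::comm_ring_1) = convolution M f (convolution M g h)"
proof -
  interpret monoid M by fact
  let ?s = "Poly_Mapping.single" and ?l = "Poly_Mapping.lookup"
  have "convolution M (convolution M f g) h = (\<Sum>a\<in>Poly_Mapping.keys f. \<Sum>b\<in>Poly_Mapping.keys g. convolution M (?s (a \<otimes>\<^bsub>M\<^esub> b) (?l f a * ?l g b)) h)"
    by (subst convolution_def) (simp only: convolution_sum_left)
  also have "\<dots> = (\<Sum>a\<in>Poly_Mapping.keys f. \<Sum>b\<in>Poly_Mapping.keys g. \<Sum>c\<in>Poly_Mapping.keys h. ?s (a \<otimes>\<^bsub>M\<^esub> b \<otimes>\<^bsub>M\<^esub> c) (?l f a * ?l g b * ?l h c))"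
    by (subst poly_mapping_decomp[of h]) (simp only: convolution_sum_right convolution_single)
  finally have 1: "convolution M (convolution M f g) h = \<dots>" .
  have "convolution M f (convolution M g h) = (\<Sum>b\<in>Poly_Mapping.keys g. \<Sum>c\<in>Poly_Mapping.keys h. convolution M f (?s (b \<otimes>\<^bsub>M\<^esub> c) (?l g b * ?l h c)))"
    by (subst (2) convolution_def) (simp only: convolution_sum_right)
  also have "\<dots> = (\<Sum>b\<in>Poly_Mapping.keys g. \<Sum>c\<in>Poly_Mapping.keys h. convolution M (\<Sum>a\<in>Poly_Mapping.keys f. ?s a (?l f a)) (?s (b \<otimes>\<^bsub>M\<^esub> c) (?l g b * ?l h c)))"
    by (simp only: poly_mapping_decomp[of f, symmetric])
  also have "\<dots> = (\<Sum>b\<in>Poly_Mapping.keys g. \<Sum>c\<in>Poly_Mapping.keys h. \<Sum>a\<in>Poly_Mapping.keys f. ?s (a \<otimes>\<^bsub>M\<^esub> (b \<otimes>\<^bsub>M\<^esub> c)) (?l f a * (?l g b * ?l h c)))"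
    by (simp only: convolution_sum_left convolution_single)
  also have "\<dots> = (\<Sum>b\<in>Poly_Mapping.keys g. \<Sum>a\<in>Poly_Mapping.keys f. \<Sum>c\<in>Poly_Mapping.keys h. ?s (a \<otimes>\<^bsub>M\<^esub> (b \<otimes>\<^bsub>M\<^esub> c)) (?l f a * (?l g b * ?l h c)))"
    by (intro sum.cong refl sum.swap)
  also have "\<dots> = (\<Sum>a\<in>Poly_Mapping.keys f. \<Sum>b\<in>Poly_Mapping.keys g. \<Sum>c\<in>Poly_Mapping.keys h. ?s (a \<otimes>\<^bsub>M\<^esub> (b \<otimes>\<^bsub>M\<^esub> c)) (?l f a * (?l g b * ?l h c)))"
    by (rule sum.swap)
  also have "\<dots> = (\<Sum>a\<in>Poly_Mapping.keys f. \<Sum>b\<in>Poly_Mapping.keys g. \<Sum>c\<in>Poly_Mapping.keys h. ?s (a \<otimes>\<^bsub>M\<^esub> b \<otimes>\<^bsub>M\<^esub> c) (?l f a * ?l g b * ?l h c))"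
    by (intro sum.cong refl) (use assms in \<open>simp add: m_assoc subset_iff mult.assoc\<close>)
  finally show ?thesis using 1 by simp
qed

lemma convolution_one: assumes "monoid M" "Poly_Mapping.keys f \<subseteq> carrier M"
  shows "convolution M (Poly_Mapping.single \<one>\<^bsub>M\<^esub> 1) (f::'a \<Rightarrow>\<^sub>0 'r::comm_ring_1) = f"
   "convolution M f (Poly_Mapping.single \<one>\<^bsub>M\<^esub> 1) = f"
proof -
  interpret monoid M by fact
  show "convolution M (Poly_Mapping.single \<one>\<^bsub>M\<^esub> 1) f = f"
    apply (subst (2) poly_mapping_decomp[of f]) using assms(2)
    by (subst convolution_superset[of "{\<one>\<^bsub>M\<^esub>}" "Poly_Mapping.keys f"]) (auto simp: subset_iff intro!: sum.cong)
  show "convolution M f (Poly_Mapping.single \<one>\<^bsub>M\<^esub> 1) = f"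
    apply (subst (2) poly_mapping_decomp[of f]) using assms(2)
    by (subst convolution_superset[of "Poly_Mapping.keys f" "{\<one>\<^bsub>M\<^esub>}"]) (auto simp: subset_iff intro!: sum.cong)
qed

lemma monoid_algebra_ring: assumes "monoid M" shows "ring (monoid_algebra M :: ('r::comm_ring_1, 'a \<Rightarrow>\<^sub>0 'r) module)"
proof (rule ringI)
  interpret monoid M by fact
  show "abelian_group (monoid_algebra M :: ('r::comm_ring_1, 'a \<Rightarrow>\<^sub>0 'r) module)"
    apply (rule abelian_groupI)
         apply (auto simp: monoid_algebra_def add.assoc add.commute dest!: subsetD[OF Poly_Mapping.keys_add])
    subgoal for x by (rule exI[of _ "-x"]) (auto simp: in_keys_iff)
    done
  show "monoid (monoid_algebra M :: ('r::comm_ring_1, 'a \<Rightarrow>\<^sub>0 'r) module)"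
    apply (rule monoidI)
    using assms by (simp_all add: monoid_algebra_def convolution_assoc convolution_one convolution_carrier del: keys_single) auto
qed (simp_all add: monoid_algebra_def convolution_add_left convolution_add_right)

lemma quotient_algebra_ring: assumes "ideal I A" shows "ring (quotient_algebra A I)"
proof -
  interpret ideal I A by fact
  interpret Q: ring "A Quot I" by (rule quotient_is_ring)
  show ?thesis
    apply (rule ringI)
    subgoal apply (rule abelian_groupI) using Q.add.l_inv_ex
      by (auto simp: quotient_algebra_def ring.defs Q.a_assoc Q.a_comm Q.a_lcomm simp del: set_eq_iff) 
    subgoal apply (rule monoidI) by (auto simp: quotient_algebra_def ring.defs Q.m_assoc)
    by (auto simp: quotient_algebra_def ring.defs Q.l_distr Q.r_distr)
qed

lemma free_monoid_monoid: "monoid (free_monoid G)" by (rule monoidI) (auto simp: free_monoid_def)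

lemma blob_relations_carrier: "blob_relations n q q' g d \<subseteq> carrier (free_algebra (blob_gens n))"
proof
  fix f assume "f \<in> blob_relations n q q' g d"
  then show "f \<in> carrier (free_algebra (blob_gens n))"
    by cases (auto simp: free_algebra_def monoid_algebra_def free_monoid_def blob_gens_def
       dest!: subsetD[OF keys_diff] split: if_splits)
qed

lemma blob_algebra_K_ring: "ring (blob_algebra_K n q q' g d)"
  unfolding blob_algebra_K_def presented_algebra_def
  by (intro quotient_algebra_ring ring.genideal_ideal blob_relations_carrier) (simp add: free_algebra_def monoid_algebra_ring free_monoid_monoid)

lemma monoid_algebra_smult: "monoid M \<Longrightarrow> f \<in> carrier (monoid_algebra M) \<Longrightarrow> 
  c \<odot>\<^bsub>monoid_algebra M\<^esub> f = Poly_Mapping.single \<one>\<^bsub>M\<^esub> c \<otimes>\<^bsub>monoid_algebra M\<^esub> f"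
proof -
  assume "monoid M" and f: "f \<in> carrier (monoid_algebra M)"
  then interpret monoid M by simp
  have "convolution M (Poly_Mapping.single \<one>\<^bsub>M\<^esub> c) f = (\<Sum>b\<in>Poly_Mapping.keys f. Poly_Mapping.single b (c * Poly_Mapping.lookup f b))"
    using f by (subst convolution_superset[of "{\<one>\<^bsub>M\<^esub>}" "Poly_Mapping.keys f"]) (auto simp: monoid_algebra_def subset_iff intro!: sum.cong)
  also have "\<dots> = Poly_Mapping.map ((*) c) f"
    by (rule poly_mapping_eqI) (auto simp: lookup_smult lookup_sum lookup_single when_def sum.delta in_keys_iff)
  finally show ?thesis by (simp add: monoid_algebra_def)
qed

lemma quotient_algebra_smult: assumes M: "monoid M" and I: "ideal I (monoid_algebra M)" and f: "f \<in> carrier (monoid_algebra M)"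
  shows "c \<odot>\<^bsub>quotient_algebra (monoid_algebra M) I\<^esub> (I +>\<^bsub>monoid_algebra M\<^esub> f)
    = I +>\<^bsub>monoid_algebra M\<^esub> (c \<odot>\<^bsub>monoid_algebra M\<^esub> f)"
proof -
  interpret ideal I "monoid_algebra M" by fact
  interpret mm: monoid M by fact
  let ?A = "monoid_algebra M" let ?c = "Poly_Mapping.single \<one>\<^bsub>M\<^esub> c"
  have c: "?c \<in> carrier ?A" by (auto simp: monoid_algebra_def)
  have *: "I +>\<^bsub>?A\<^esub> (c \<odot>\<^bsub>?A\<^esub> a) = I +>\<^bsub>?A\<^esub> (c \<odot>\<^bsub>?A\<^esub> f)" if a: "a \<in> I +>\<^bsub>?A\<^esub> f" for a
  proof -
    have ac: "a \<in> carrier ?A" using a f a_r_coset_subset_G a_subset by blast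
    from a obtain i where i: "i \<in> I" "a = i \<oplus>\<^bsub>?A\<^esub> f" by (auto simp: a_r_coset_def')
    have "?c \<otimes>\<^bsub>?A\<^esub> a = ?c \<otimes>\<^bsub>?A\<^esub> i \<oplus>\<^bsub>?A\<^esub> ?c \<otimes>\<^bsub>?A\<^esub> f" using i f c a_subset by (auto simp: r_distr subset_iff)
    then have "?c \<otimes>\<^bsub>?A\<^esub> a \<in> I +>\<^bsub>?A\<^esub> (?c \<otimes>\<^bsub>?A\<^esub> f)" using I_l_closed[OF i(1) c] by (auto simp: a_r_coset_def')
    then show ?thesis using monoid_algebra_smult[OF M f] monoid_algebra_smult[OF M ac] c f
      by (metis a_repr_independence' local.ring_axioms m_closed)
  qed
  have "f \<in> I +>\<^bsub>?A\<^esub> f" using f by (simp add: a_rcos_self)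
  then have "(\<Union>a\<in>I +>\<^bsub>?A\<^esub> f. I +>\<^bsub>?A\<^esub> (c \<odot>\<^bsub>?A\<^esub> a)) = I +>\<^bsub>?A\<^esub> (c \<odot>\<^bsub>?A\<^esub> f)"
    using * by blast
  then show ?thesis by (simp add: quotient_algebra_def ring.defs)
qed

lemma blob_algebra_K_smult_closed: assumes "a \<in> carrier (blob_algebra_K n q q' g d)"
  shows "c \<odot>\<^bsub>blob_algebra_K n q q' g d\<^esub> a \<in> carrier (blob_algebra_K n q q' g d)"
proof -
  let ?M = "free_monoid (blob_gens n)" let ?A = "monoid_algebra ?M :: ('a, blob_gen list \<Rightarrow>\<^sub>0 'a) module"
  let ?I = "Idl\<^bsub>?A\<^esub> (blob_relations n q q' g d)"
  interpret A: ring ?A by (simp add: monoid_algebra_ring free_monoid_monoid)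
  interpret I: ideal ?I ?A by (intro A.genideal_ideal) (use blob_relations_carrier in \<open>simp add: free_algebra_def\<close>)
  have B: "blob_algebra_K n q q' g d = quotient_algebra ?A ?I" by (simp add: blob_algebra_K_def presented_algebra_def free_algebra_def)
  from assms obtain f where f: "f \<in> carrier ?A" "a = ?I +>\<^bsub>?A\<^esub> f"
    unfolding B by (auto simp: quotient_algebra_def ring.defs FactRing_simps)
  have "c \<odot>\<^bsub>?A\<^esub> f \<in> carrier ?A" unfolding monoid_algebra_smult[OF free_monoid_monoid f(1)]
    by (rule A.m_closed[OF _ f(1)]) (auto simp: monoid_algebra_def free_monoid_def)
  then show ?thesis unfolding B f(2) quotient_algebra_smult[OF free_monoid_monoid I.ideal_axioms f(1)]
    by (auto simp: quotient_algebra_def ring.defs FactRing_simps)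
qed

lemma scalar_relations_carrier: "ring A \<Longrightarrow> (\<And>c a. a \<in> carrier A \<Longrightarrow> c \<odot>\<^bsub>A\<^esub> a \<in> carrier A) \<Longrightarrow>
   scalar_relations \<phi> A \<subseteq> carrier (monoid_algebra A)"
proof -
  assume "ring A" and s: "\<And>c a. a \<in> carrier A \<Longrightarrow> c \<odot>\<^bsub>A\<^esub> a \<in> carrier A"
  then interpret ring A by simp
  show ?thesis
    by (auto simp: scalar_relations_def monoid_algebra_def s
        dest!: subsetD[OF keys_diff] subsetD[OF Poly_Mapping.keys_add] split: if_splits)
qed

lemma blob_algebra_ring: "ring (blob_algebra \<phi> n q q' g d)"
  unfolding blob_algebra_def extend_scalars_def
  by (intro quotient_algebra_ring ring.genideal_ideal monoid_algebra_ring scalar_relations_carrier blob_algebra_K_ring blob_algebra_K_smult_closed) (auto intro: blob_algebra_K_ring ring.is_monoid)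

end

theory Submission
  imports Defs
begin

text \<open>A walk word is best read as the upper half of a Temperley-Lieb diagram on \<open>n\<close> points: some of the
points are joined by non-crossing arcs, and from each of the others a line runs down. A walk that ends
at level \<open>2 c + a\<close> and weight \<open>\<plusminus> a\<close> describes a half-diagram with \<open>c\<close> arcs and \<open>a\<close> lines: a step
away from weight 0 adds a line at the right end, a step towards 0 joins the rightmost line to the new
point by an arc. The generator \<open>e\<close> puts a decoration on the leftmost line, so the sign of the weight
says whether that line is decorated. Below the lines, every word ends in the same standard pattern of
\<open>c\<close> arcs on the first \<open>2 c\<close> points. The picture guides the proof, which computes with the relations.

The computations rest on a few rules for \<open>T\<^sub>s = U\<^sub>s U\<^bsub>s-1\<^esub> \<cdots> U\<^sub>1\<close>, the word of a step towards 0, and for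
\<open>D\<^sub>c\<close>, the word that decorates: a letter, another \<open>T\<^sub>i\<close> or a decoration that lies to the left of the new
arc of \<open>T\<^sub>s\<close> moves to the right past \<open>T\<^sub>s\<close> and is only shifted by two places (lemmas \<open>u_T_shift\<close>,
\<open>T_T\<close>, \<open>D_T\<close>). The reason is that the new arc comes with an arc at the bottom left, which pushes
everything else two places to the right.

The heart is lemma \<open>u_half\<close>, together with \<open>e_half\<close>: the product of a generator and the element of a
half-diagram straightens. That is, it is a scalar multiple of an element of the same type, or it has
become decorated, or it equals such an element followed by a \<open>U\<^sub>i\<close> that joins two of its \<open>a\<close> lines,
with perhaps a decoration below.
The set of these results is stable under every step of a walk; for the arc that follows a joining
\<open>U\<^sub>i\<close> the reason is lemma \<open>half_close\<close>, by which joining two neighbouring lines with an arc gives a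
half-diagram again. So \<open>U\<^sub>i\<close>, which commutes with all that happens up to level \<open>i - 1\<close>, need be
compared only with the two steps through level \<open>i\<close> (lemma \<open>half_last_u\<close>).

The error terms lie where they should. Becoming decorated changes the weight \<open>m < 0\<close> to \<open>- m\<close>. An
element with \<open>c\<close> arcs ends in \<open>U\<^sub>1 U\<^sub>3 \<cdots> U\<^bsub>2c-1\<^esub>\<close>, and joining two of its lines lets it factor through
\<open>U\<^sub>1 U\<^sub>3 \<cdots> U\<^bsub>2c+1\<^esub>\<close>, which is \<open>E\<^bsub>|m|-2\<^esub>\<close> (lemma \<open>straightens_cases\<close>). Joining takes two lines, so this
does not occur for \<open>|m| \<le> 1\<close>. As the generators and the scalars generate the algebra, a span
that the generators preserve modulo a left ideal is a left ideal modulo that left ideal.\<close>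

section \<open>Shift rules in the blob monoid\<close>

text \<open>The relations of the blob algebra only multiply words, except for the scalars \<open>q + q\<inverse>\<close>, \<open>\<gamma>\<close> and
\<open>\<delta>\<close>. Treating these as elements of a set \<open>Z\<close> of central elements makes the computation one in a
monoid. The \<open>u i\<close> with \<open>i\<close> outside \<open>{1..<n}\<close> are arbitrary, so that closure has no side condition.\<close>

locale blob_generators = monoid G for G (structure) +
  fixes n :: nat and e :: 'a and u :: "nat \<Rightarrow> 'a" and Z :: "'a set" and d \<gamma> \<delta> :: 'a
  assumes e_closed [simp]: "e \<in> carrier G"
    and u_closed [simp]: "u i \<in> carrier G"
    and Z_closed: "z \<in> Z \<Longrightarrow> z \<in> carrier G"
    and Z_central: "z \<in> Z \<Longrightarrow> v \<in> carrier G \<Longrightarrow> v \<otimes> z = z \<otimes> v"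
    and one_Z: "\<one> \<in> Z" and d_Z: "d \<in> Z" and \<gamma>_Z: "\<gamma> \<in> Z" and \<delta>_Z: "\<delta> \<in> Z"
    and u_square: "1 \<le> i \<Longrightarrow> i < n \<Longrightarrow> u i \<otimes> u i = d \<otimes> u i"
    and u_braid_up: "1 \<le> i \<Longrightarrow> Suc i < n \<Longrightarrow> u i \<otimes> (u (Suc i) \<otimes> u i) = u i"
    and u_braid_down: "1 \<le> i \<Longrightarrow> Suc i < n \<Longrightarrow> u (Suc i) \<otimes> (u i \<otimes> u (Suc i)) = u (Suc i)"
    and u_far: "1 \<le> i \<Longrightarrow> i + 2 \<le> k \<Longrightarrow> k < n \<Longrightarrow> u k \<otimes> u i = u i \<otimes> u k"
    and u_e_u: "1 < n \<Longrightarrow> u 1 \<otimes> (e \<otimes> u 1) = \<gamma> \<otimes> u 1"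
    and e_square: "e \<otimes> e = \<delta> \<otimes> e"
    and u_e: "2 \<le> k \<Longrightarrow> k < n \<Longrightarrow> u k \<otimes> e = e \<otimes> u k"
begin

lemma d_closed [simp]: "d \<in> carrier G" and \<gamma>_closed [simp]: "\<gamma> \<in> carrier G"
  and \<delta>_closed [simp]: "\<delta> \<in> carrier G"
  using d_Z \<gamma>_Z \<delta>_Z Z_closed by auto

lemma Z_left_commute:
  "z \<in> Z \<Longrightarrow> v \<in> carrier G \<Longrightarrow> w \<in> carrier G \<Longrightarrow> v \<otimes> (z \<otimes> w) = z \<otimes> (v \<otimes> w)"
  using Z_central[of z v] Z_closed[of z] by (simp add: m_assoc[symmetric])

lemma u_braid_up_assoc:
  "1 \<le> i \<Longrightarrow> Suc i < n \<Longrightarrow> v \<in> carrier G \<Longrightarrow> u i \<otimes> (u (Suc i) \<otimes> (u i \<otimes> v)) = u i \<otimes> v"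
  using u_braid_up[of i] by (simp add: m_assoc[symmetric])

lemma u_braid_down_assoc:
  "1 \<le> i \<Longrightarrow> Suc i < n \<Longrightarrow> v \<in> carrier G \<Longrightarrow>
    u (Suc i) \<otimes> (u i \<otimes> (u (Suc i) \<otimes> v)) = u (Suc i) \<otimes> v"
  using u_braid_down[of i] by (simp add: m_assoc[symmetric])

lemma u_far_assoc:
  "1 \<le> i \<Longrightarrow> i + 2 \<le> k \<Longrightarrow> k < n \<Longrightarrow> v \<in> carrier G \<Longrightarrow>
    u k \<otimes> (u i \<otimes> v) = u i \<otimes> (u k \<otimes> v)"
  using u_far[of i k] by (simp add: m_assoc[symmetric])

lemma u_e_assoc:
  "2 \<le> k \<Longrightarrow> k < n \<Longrightarrow> v \<in> carrier G \<Longrightarrow> u k \<otimes> (e \<otimes> v) = e \<otimes> (u k \<otimes> v)"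
  using u_e[of k] by (simp add: m_assoc[symmetric])

primrec T :: "nat \<Rightarrow> 'a" where
  "T 0 = \<one>"
| "T (Suc s) = u (Suc s) \<otimes> T s"

lemma T_closed [simp]: "T s \<in> carrier G"
  by (induction s) auto

lemma u_T_above: "s + 2 \<le> k \<Longrightarrow> k < n \<Longrightarrow> u k \<otimes> T s = T s \<otimes> u k"
proof (induction s)
  case (Suc s)
  then show ?case using u_far_assoc[of "Suc s" k "T s"] by (simp add: m_assoc)
qed simp

lemma u_T_adjacent: "1 \<le> s \<Longrightarrow> Suc s < n \<Longrightarrow> u s \<otimes> T (Suc s) = T s"
  using u_braid_up_assoc[of s "T (s - 1)"] by (cases s) simp_all

lemma u_T_same: "1 \<le> s \<Longrightarrow> s < n \<Longrightarrow> u s \<otimes> T s = d \<otimes> T s"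
  using u_square[of s] by (cases s) (simp_all add: m_assoc[symmetric])

text \<open>In pictures, \<open>T s\<close> has one arc at the top, joining \<open>s\<close> and \<open>s + 1\<close>, and one at the bottom, joining 1
and 2; the lines to the left of the top arc run from \<open>j\<close> to \<open>j + 2\<close>. A \<open>u i\<close> above the lines \<open>i\<close> and \<open>i + 1\<close> slides down
along them.\<close>

lemma u_T_shift: "1 \<le> i \<Longrightarrow> i + 2 \<le> s \<Longrightarrow> s < n \<Longrightarrow> u i \<otimes> T s = T s \<otimes> u (i + 2)"
proof -
  assume "1 \<le> i" and s: "i + 2 \<le> s" "s < n"
  from s show ?thesis
  proof (induction s rule: nat_induct_at_least)
    case base
    have "u i \<otimes> T (i + 2) = u (i + 2) \<otimes> (u i \<otimes> T (Suc i))"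
      using base \<open>1 \<le> i\<close> u_far_assoc[of i "i + 2" "T (Suc i)"] by simp
    also have "\<dots> = u (i + 2) \<otimes> T i"
      using base \<open>1 \<le> i\<close> by (simp only: u_T_adjacent)
    also have "\<dots> = u (i + 2) \<otimes> (u (Suc i) \<otimes> (u (i + 2) \<otimes> T i))"
      using base \<open>1 \<le> i\<close> u_braid_down_assoc[of "Suc i" "T i"] by simp
    also have "\<dots> = T (i + 2) \<otimes> u (i + 2)"
      using base u_T_above[of i "i + 2"] by (simp add: m_assoc)
    finally show ?case .
  next
    case (Suc s)
    then have "u i \<otimes> T (Suc s) = u (Suc s) \<otimes> (u i \<otimes> T s)"
      using \<open>1 \<le> i\<close> u_far_assoc[of i "Suc s" "T s"] by simp
    then show ?case using Suc by (simp add: m_assoc)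
  qed
qed

lemma T_absorb: "2 \<le> s \<Longrightarrow> s < n \<Longrightarrow> T s \<otimes> T 2 = T s"
proof (induction s rule: nat_induct_at_least)
  case base
  then show ?case
    using u_braid_down_assoc[of 1 "u 1"] by (simp add: numeral_2_eq_2 m_assoc)
next
  case (Suc s)
  then show ?case by (simp add: m_assoc)
qed

text \<open>The same sliding for a whole arc: drawing the arc of \<open>T (i + 2)\<close> below that of \<open>T s\<close> is the same as
drawing it first, two places further to the left, before \<open>T s\<close> shifts the lines. For \<open>i = 0\<close> both sides are \<open>T s\<close>.\<close>

lemma T_T: "i + 2 \<le> s \<Longrightarrow> s < n \<Longrightarrow> T s \<otimes> T (i + 2) = T i \<otimes> T s"
proof (induction i)
  case 0
  then show ?case using T_absorb by (simp add: numeral_2_eq_2)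
next
  case (Suc i)
  have "T s \<otimes> T (Suc i + 2) = (T s \<otimes> u (Suc i + 2)) \<otimes> T (i + 2)"
    by (simp add: m_assoc)
  also have "\<dots> = u (Suc i) \<otimes> (T s \<otimes> T (i + 2))"
    using Suc.prems u_T_shift[of "Suc i" s, symmetric] by (simp add: m_assoc)
  also have "\<dots> = T (Suc i) \<otimes> T s"
    using Suc by (simp add: m_assoc)
  finally show ?case .
qed

text \<open>The word \<open>e (U\<^bsub>2c\<^esub> \<cdots> U\<^sub>4 U\<^sub>2) (U\<^bsub>2c-1\<^esub> \<cdots> U\<^sub>3 U\<^sub>1)\<close> of the step from weight 0 to weight 1 at level \<open>2 c\<close>,
with its letters rearranged so that it grows on the right.\<close>

primrec D :: "nat \<Rightarrow> 'a" where
  "D 0 = e"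
| "D (Suc c) = D c \<otimes> (u (2 * c + 2) \<otimes> u (2 * c + 1))"

lemma D_closed [simp]: "D c \<in> carrier G"
  by (induction c) auto

lemma u_D: "2 * c + 2 \<le> k \<Longrightarrow> k < n \<Longrightarrow> u k \<otimes> D c = D c \<otimes> u k"
proof (induction c)
  case 0
  then show ?case using u_e by simp
next
  case (Suc c)
  then have "u k \<otimes> D (Suc c) = D c \<otimes> (u k \<otimes> (u (2 * c + 2) \<otimes> u (2 * c + 1)))"
    by (simp add: m_assoc[symmetric])
  then show ?case
    using Suc.prems u_far[of "2 * c + 1" k] u_far_assoc[of "2 * c + 2" k "u (2 * c + 1)"]
    by (simp add: m_assoc)
qed

text \<open>\<open>D c\<close> carries a decoration to the line at position \<open>2 c + 1\<close>, by bringing this line to the left edge,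
decorating it with \<open>e\<close> and bringing it back. The arc of \<open>T s\<close> moves this line to \<open>2 c + 3\<close>, if it lies
to the right of it.\<close>

lemma D_T: "2 * c + 2 \<le> s \<Longrightarrow> s < n \<Longrightarrow> D c \<otimes> T s = T s \<otimes> D (Suc c)"
proof (induction c)
  case 0
  then have "2 \<le> s" by simp
  from this \<open>s < n\<close> have "e \<otimes> T s = T s \<otimes> (e \<otimes> (u 2 \<otimes> u 1))"
  proof (induction s rule: nat_induct_at_least)
    case base
    have "u 2 \<otimes> (u 1 \<otimes> (e \<otimes> (u 2 \<otimes> u 1))) = u 2 \<otimes> (u 1 \<otimes> (u 2 \<otimes> (e \<otimes> u 1)))"
      using base by (simp add: u_e_assoc)
    also have "\<dots> = u 2 \<otimes> (e \<otimes> u 1)"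
      using base u_braid_down_assoc[of 1 "e \<otimes> u 1"] by (simp add: numeral_2_eq_2)
    also have "\<dots> = e \<otimes> (u 2 \<otimes> u 1)"
      using base by (simp add: u_e_assoc)
    finally show ?case by (simp add: numeral_2_eq_2 m_assoc)
  next
    case (Suc s)
    then show ?case using u_e_assoc[of "Suc s" "T s"] by (simp add: m_assoc)
  qed
  then show ?case by (simp add: numeral_2_eq_2)
next
  case (Suc c)
  have "D (Suc c) \<otimes> T s = D c \<otimes> (u (2 * c + 2) \<otimes> (u (2 * c + 1) \<otimes> T s))"
    by (simp add: m_assoc)
  also have "\<dots> = D c \<otimes> (u (2 * c + 2) \<otimes> (T s \<otimes> u (2 * c + 3)))"
    using Suc.prems u_T_shift[of "2 * c + 1" s] by (simp add: numeral_eq_Suc)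
  also have "\<dots> = D c \<otimes> ((u (2 * c + 2) \<otimes> T s) \<otimes> u (2 * c + 3))"
    by (simp add: m_assoc)
  also have "\<dots> = D c \<otimes> T s \<otimes> (u (2 * c + 4) \<otimes> u (2 * c + 3))"
    using Suc.prems u_T_shift[of "2 * c + 2" s] by (simp add: m_assoc numeral_eq_Suc)
  also have "\<dots> = T s \<otimes> D (Suc (Suc c))"
    using Suc by (simp add: m_assoc numeral_eq_Suc)
  finally show ?case .
qed

lemma D_square: "2 * c < n \<Longrightarrow> D c \<otimes> D c = \<delta> \<otimes> D c"
proof (induction c)
  case 0
  then show ?case by (simp add: e_square)
next
  case (Suc c)
  let ?a = "u (2 * c + 1)" and ?b = "u (2 * c + 2)"
  have "D (Suc c) \<otimes> D (Suc c) = D c \<otimes> (?b \<otimes> (?a \<otimes> ((D c \<otimes> ?b) \<otimes> ?a)))"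
    by (simp add: m_assoc)
  also have "D c \<otimes> ?b = ?b \<otimes> D c"
    using Suc.prems u_D by simp
  \<comment> \<open>the braid relation removes the \<open>U\<^bsub>2c+1\<^esub>\<close> between the two copies of \<open>U\<^bsub>2c+2\<^esub>\<close>\<close>
  also have "D c \<otimes> (?b \<otimes> (?a \<otimes> ((?b \<otimes> D c) \<otimes> ?a))) = D c \<otimes> ((?b \<otimes> D c) \<otimes> ?a)"
    using Suc.prems u_braid_down_assoc[of "2 * c + 1" "D c \<otimes> ?a"] by (simp add: m_assoc)
  also have "\<dots> = (D c \<otimes> D c) \<otimes> (?b \<otimes> ?a)"
    using Suc.prems u_D by (simp add: m_assoc)
  also have "\<dots> = \<delta> \<otimes> D (Suc c)"
    using Suc by (simp add: m_assoc)
  finally show ?case .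
qed

text \<open>The product \<open>U\<^sub>1 U\<^sub>3 \<cdots> U\<^bsub>2c-1\<^esub>\<close>: its lower half is the standard pattern of \<open>c\<close> arcs on the left.\<close>

primrec Cups :: "nat \<Rightarrow> 'a" where
  "Cups 0 = \<one>"
| "Cups (Suc c) = Cups c \<otimes> u (2 * c + 1)"

lemma Cups_closed [simp]: "Cups c \<in> carrier G"
  by (induction c) auto

lemma u_Cups: "2 * c + 1 \<le> k \<Longrightarrow> k < n \<Longrightarrow> u k \<otimes> Cups c = Cups c \<otimes> u k"
proof (induction c)
  case (Suc c)
  then have "u k \<otimes> Cups (Suc c) = Cups c \<otimes> (u k \<otimes> u (2 * c + 1))"
    by (simp add: m_assoc[symmetric])
  then show ?case using Suc.prems u_far[of "2 * c + 1" k] by (simp add: m_assoc)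
qed simp

text \<open>The bottom arc of \<open>T s\<close> becomes the new leftmost arc and pushes the old ones two places to the right.
The factor on the left does not depend on \<open>c\<close> because it is \<open>U\<^sub>s \<cdots> U\<^sub>2\<close>.\<close>

lemma Cups_T: "\<exists>y\<in>carrier G. \<forall>c. 2 * c < s \<longrightarrow> s < n \<longrightarrow> Cups c \<otimes> T s = y \<otimes> Cups (Suc c)"
proof -
  have "\<exists>y\<in>carrier G. 0 < s \<longrightarrow> T s = y \<otimes> u 1"
  proof (induction s)
    case (Suc s)
    then obtain y where y: "y \<in> carrier G" "0 < s \<longrightarrow> T s = y \<otimes> u 1" by blast
    show ?case
    proof (cases s)
      case 0
      then show ?thesis by (intro bexI[of _ \<one>]) auto
    next
      case (Suc t)
      then show ?thesis using y by (intro bexI[of _ "u (Suc s) \<otimes> y"]) (auto simp: m_assoc)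
    qed
  qed auto
  then obtain y where y: "y \<in> carrier G" "0 < s \<longrightarrow> T s = y \<otimes> u 1" by blast
  have "Cups c \<otimes> T s = y \<otimes> Cups (Suc c)" if "2 * c < s" "s < n" for c
    using that
  proof (induction c)
    case 0
    then show ?case using y by simp
  next
    case (Suc c)
    have "Cups (Suc c) \<otimes> T s = (Cups c \<otimes> T s) \<otimes> u (2 * c + 3)"
      using Suc.prems u_T_shift[of "2 * c + 1" s] by (simp add: m_assoc numeral_eq_Suc)
    also have "\<dots> = y \<otimes> Cups (Suc (Suc c))"
      using Suc.IH Suc.prems y by (simp add: m_assoc numeral_eq_Suc)
    finally show ?case .
  qed
  then show ?thesis using y by blast
qed

lemma D_Cups: "2 * c < n \<Longrightarrow> \<exists>y\<in>carrier G. D c = y \<otimes> Cups c"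
proof (induction c)
  case 0
  then show ?case by (intro bexI[of _ e]) auto
next
  case (Suc c)
  then obtain y where y: "y \<in> carrier G" "D c = y \<otimes> Cups c" by auto
  have "D (Suc c) = y \<otimes> (Cups c \<otimes> u (2 * c + 2)) \<otimes> u (2 * c + 1)"
    using y by (simp add: m_assoc)
  also have "\<dots> = (y \<otimes> u (2 * c + 2)) \<otimes> Cups (Suc c)"
    using Suc.prems y by (simp add: u_Cups[symmetric] m_assoc)
  finally show ?case using y by (intro bexI[of _ "y \<otimes> u (2 * c + 2)"]) simp_all
qed

text \<open>When the line of the new arc lies just to the right of all arcs, \<open>T\<close> does nothing but complete the
row of arcs, just like the single letter \<open>U\<^bsub>2c+1\<^esub>\<close>.\<close>

lemma Cups_T_top: "2 * c + 1 < n \<Longrightarrow> Cups c \<otimes> T (2 * c + 1) = Cups (Suc c)"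
proof (induction c)
  case (Suc c)
  have "Cups (Suc c) \<otimes> T (2 * Suc c + 1) = Cups c \<otimes> (u (2 * c + 1) \<otimes> T (2 * c + 3))"
    by (simp add: m_assoc numeral_eq_Suc)
  also have "\<dots> = Cups c \<otimes> (u (2 * c + 3) \<otimes> T (2 * c + 1))"
    using Suc.prems u_far_assoc[of "2 * c + 1" "2 * c + 3" "T (2 * c + 2)"] u_T_adjacent[of "2 * c + 1"]
    by (simp add: numeral_eq_Suc)
  also have "\<dots> = (Cups c \<otimes> T (2 * c + 1)) \<otimes> u (2 * c + 3)"
    using Suc.prems u_T_above[of "2 * c + 1" "2 * c + 3"] by (simp add: m_assoc)
  finally show ?case using Suc by (simp add: numeral_eq_Suc)
qed simp

text \<open>An arc exposed to the left edge, decorated, and closed from below is a decorated circle, and has the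
value \<open>\<gamma>\<close>. In the induction the circle slides to the left over one arc after the other, until the
relation \<open>U\<^sub>1 e U\<^sub>1 = \<gamma> U\<^sub>1\<close> applies.\<close>

lemma Cups_D_T: "2 * c + 1 < n \<Longrightarrow> Cups (Suc c) \<otimes> (D c \<otimes> T (2 * c + 1)) = \<gamma> \<otimes> Cups (Suc c)"
proof (induction c)
  case 0
  then show ?case using u_e_u by simp
next
  case (Suc c)
  let ?a = "u (2 * c + 1)" and ?b = "u (2 * c + 2)" and ?c = "u (2 * c + 3)"
  have n: "2 * c + 3 < n" using Suc.prems by simp
  have "?a \<otimes> T (2 * c + 3) = ?c \<otimes> T (2 * c + 1)"
    using n u_far_assoc[of "2 * c + 1" "2 * c + 3" "T (2 * c + 2)"] u_T_adjacent[of "2 * c + 1"]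
    by (simp add: numeral_eq_Suc)
  moreover have "T (2 * Suc c + 1) = T (2 * c + 3)" by (simp add: numeral_eq_Suc)
  ultimately have "D (Suc c) \<otimes> T (2 * Suc c + 1) = D c \<otimes> (?b \<otimes> (?c \<otimes> T (2 * c + 1)))"
    by (simp add: m_assoc del: T.simps)
  also have "\<dots> = ?b \<otimes> (?c \<otimes> (D c \<otimes> T (2 * c + 1)))"
    using n u_D[of c "2 * c + 2"] u_D[of c "2 * c + 3"]
    by (simp add: m_assoc[symmetric] del: T.simps)
  finally have "Cups (Suc (Suc c)) \<otimes> (D (Suc c) \<otimes> T (2 * Suc c + 1)) =
      Cups (Suc c) \<otimes> (?c \<otimes> (?b \<otimes> (?c \<otimes> (D c \<otimes> T (2 * c + 1)))))"
    by (simp add: m_assoc numeral_eq_Suc del: T.simps)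
  also have "\<dots> = Cups (Suc c) \<otimes> ((?c \<otimes> D c) \<otimes> T (2 * c + 1))"
    using n u_braid_down_assoc[of "2 * c + 2" "D c \<otimes> T (2 * c + 1)"]
    by (simp add: numeral_eq_Suc m_assoc del: T.simps)
  also have "\<dots> = (Cups (Suc c) \<otimes> (D c \<otimes> T (2 * c + 1))) \<otimes> ?c"
    using n u_D[of c "2 * c + 3"] u_T_above[of "2 * c + 1" "2 * c + 3"]
    by (simp add: m_assoc del: T.simps Cups.simps)
  also have "\<dots> = \<gamma> \<otimes> Cups (Suc (Suc c))"
    using Suc by (simp add: m_assoc numeral_eq_Suc del: T.simps)
  finally show ?case .
qed

section \<open>Words as decorated half-diagrams\<close>

text \<open>\<open>half c b a v\<close> says that \<open>v\<close> is the element of a walk to level \<open>2 c + a\<close> and weight \<open>a\<close> (if \<open>b\<close>) or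
\<open>- a\<close> (if not). Counting arcs and lines instead of level and weight turns the two mirror-image
families of steps into one, and records parity and range of the weight for free. At weight 0 the
flag is \<open>False\<close>, since there is no line to be decorated.\<close>

inductive half :: "nat \<Rightarrow> bool \<Rightarrow> nat \<Rightarrow> 'a \<Rightarrow> bool" where
  start: "half 0 False 0 \<one>"
| away: "half c b a v \<Longrightarrow> half c b (Suc a) v"
| decorate: "half c False 0 v \<Longrightarrow> half c True 1 (v \<otimes> D c)"
| toward: "half c b (Suc a) v \<Longrightarrow> half (Suc c) (b \<and> 0 < a) a (v \<otimes> T (2 * c + a + 1))"

lemma half_closed: "half c b a v \<Longrightarrow> v \<in> carrier G"
  by (induction rule: half.induct) auto

lemma half_decorated: "half c b a v \<Longrightarrow> b \<Longrightarrow> 0 < a"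
  by (induction rule: half.induct) auto

lemma half_commute: "half c b a v \<Longrightarrow> 2 * c + a < k \<Longrightarrow> k < n \<Longrightarrow> u k \<otimes> v = v \<otimes> u k"
proof (induction rule: half.induct)
  case (decorate c v)
  have "u k \<otimes> (v \<otimes> D c) = v \<otimes> (u k \<otimes> D c)"
    using decorate half_closed[of c False 0 v] by (simp add: m_assoc[symmetric])
  then show ?case
    using decorate half_closed[of c False 0 v] u_D[of c k] by (simp add: m_assoc)
next
  case (toward c b a v)
  have "u k \<otimes> (v \<otimes> T (2 * c + a + 1)) = v \<otimes> (u k \<otimes> T (2 * c + a + 1))"
    using toward half_closed[OF toward.hyps] by (simp add: m_assoc[symmetric])
  then show ?case
    using toward half_closed[OF toward.hyps] u_T_above[of "2 * c + a + 1" k] by (simp add: m_assoc)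
qed auto

text \<open>All words end in the same lower half, which consists of the standard arcs.\<close>

lemma half_Cups: "half c b a v \<Longrightarrow> 2 * c + a \<le> n \<Longrightarrow> \<exists>y\<in>carrier G. v = y \<otimes> Cups c"
proof (induction rule: half.induct)
  case start
  then show ?case by (intro bexI[of _ \<one>]) auto
next
  case (decorate c v)
  moreover obtain y where "y \<in> carrier G" "D c = y \<otimes> Cups c"
    using D_Cups[of c] decorate.prems by auto
  ultimately show ?case
    by (intro bexI[of _ "v \<otimes> y"]) (auto simp: m_assoc half_closed)
next
  case (toward c b a v)
  then obtain y where y: "y \<in> carrier G" "v = y \<otimes> Cups c" by auto
  obtain y' where y': "y' \<in> carrier G" "Cups c \<otimes> T (2 * c + a + 1) = y' \<otimes> Cups (Suc c)"
    using Cups_T[of "2 * c + a + 1"] toward.prems by auto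
  show ?case
    using y y' by (intro bexI[of _ "y \<otimes> y'"]) (simp_all add: m_assoc del: Cups.simps)
qed auto

text \<open>Joining the lines at the positions \<open>i\<close> and \<open>i + 1\<close> yields again the element of one half-diagram,
with no scalar. In terms of walks, the step that created the second of these lines is reversed, and
the walk after it stays two units closer to 0; the commutation rule \<open>T_T\<close> moves the joining arc to
that step. The decoration survives unless it was on one of the two lines, that is, unless
\<open>i = 2 c + 1\<close>.\<close>

lemma half_close:
  "half c b a v \<Longrightarrow> 2 * c < i \<Longrightarrow> i < 2 * c + a \<Longrightarrow> 2 * c + a \<le> n \<Longrightarrow>
    half (Suc c) (b \<and> 2 * c + 1 < i) (a - 2) (v \<otimes> T i)"
proof (induction arbitrary: i rule: half.induct)
  case (away c b a v)
  show ?case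
  proof (cases "i = 2 * c + a")
    case True
    with away.prems obtain a' where a: "a = Suc a'" by (cases a) auto
    then show ?thesis using half.toward[of c b a' v] away.hyps True by simp
  next
    case False
    with away have "half (Suc c) (b \<and> 2 * c + 1 < i) (a - 2) (v \<otimes> T i)" by simp
    moreover have "Suc (a - 2) = Suc a - 2" using False away.prems by simp
    ultimately show ?thesis using half.away by metis
  qed
next
  case (toward c b a v)
  \<comment> \<open>two lines are joined, so at least two remain after the step; before the step they lay two places to the left\<close>
  define j a' where "j = i - 2" and "a' = a - 2"
  then have i: "i = j + 2" and a: "a = a' + 2" using toward.prems by auto
  have "half (Suc c) (b \<and> 2 * c + 1 < j) (Suc a') (v \<otimes> T j)"
    using toward.IH[of j] toward.prems i a by simp
  from half.toward[OF this]
  have "half (Suc (Suc c)) (b \<and> 2 * Suc c + 1 < i) a' (v \<otimes> T j \<otimes> T (2 * Suc c + a' + 1))"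
    using toward.prems i a by (auto elim!: back_subst[of "\<lambda>b. half _ b _ _"])
  moreover have "v \<otimes> T j \<otimes> T (2 * Suc c + a' + 1) = v \<otimes> T (2 * c + a + 1) \<otimes> T i"
    using toward.prems i a T_T[of j "2 * c + a + 1"] half_closed[OF toward.hyps]
    by (simp add: m_assoc del: T.simps)
  ultimately show ?case using a toward.prems by auto
qed auto

text \<open>The decoration slides up its line to the step that created the line, by \<open>D_T\<close>, and changes the walk
from this step on into its mirror image.\<close>

lemma half_decorate_first:
  "half c b a v \<Longrightarrow> \<not> b \<Longrightarrow> 0 < a \<Longrightarrow> 2 * c + a \<le> n \<Longrightarrow> half c True a (v \<otimes> D c)"
proof (induction rule: half.induct)
  case (away c b a v)
  then show ?case using half.decorate[of c v] half.away[of c True a] by (cases "a = 0") auto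
next
  case (toward c b a v)
  have "\<not> b" using toward by auto
  with toward have "half c True (Suc a) (v \<otimes> D c)" by auto
  from half.toward[OF this] show ?case
    using toward.prems D_T[of c "2 * c + a + 1"] half_closed[OF toward.hyps]
    by (simp add: m_assoc del: D.simps T.simps)
qed auto

lemma half_decorate_twice:
  "half c b a v \<Longrightarrow> b \<Longrightarrow> 2 * c + a \<le> n \<Longrightarrow> v \<otimes> D c = \<delta> \<otimes> v"
proof (induction rule: half.induct)
  case (decorate c v)
  then show ?case
    using half_closed[of c False 0 v] D_square[of c] Z_left_commute[OF \<delta>_Z]
    by (simp add: m_assoc)
next
  case (toward c b a v)
  have v: "v \<in> carrier G" by (rule half_closed) fact
  have "v \<otimes> T (2 * c + a + 1) \<otimes> D (Suc c) = v \<otimes> D c \<otimes> T (2 * c + a + 1)"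
    using toward.prems D_T[of c "2 * c + a + 1"] v by (simp add: m_assoc del: D.simps T.simps)
  also have "\<dots> = \<delta> \<otimes> (v \<otimes> T (2 * c + a + 1))"
    using toward v by (simp add: m_assoc del: T.simps)
  finally show ?case .
qed auto

section \<open>Straightening a generator times a half-diagram\<close>

text \<open>The four possible results of multiplying a half-diagram of type \<open>(c, b, a)\<close> by a generator: a scalar
multiple of a half-diagram of the same type; a decorated one where there was no decoration; one with
two neighbouring lines joined by a letter below, the decorated line not being involved; and one whose
first two lines are joined by an undecorated arc, while a decoration remains below it.
The last two keep an explicit joining letter because the arc of a later step may end at it from below,
and then one of the two joined lines is back.\<close>

definition straightens :: "nat \<Rightarrow> bool \<Rightarrow> nat \<Rightarrow> 'a \<Rightarrow> bool" where
  "straightens c b a x \<longleftrightarrow>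
    (\<exists>z\<in>Z. \<exists>v. half c b a v \<and> x = z \<otimes> v) \<or>
    (\<not> b \<and> 0 < a \<and> half c True a x) \<or>
    (\<exists>v i. half c b a v \<and> 2 * c + of_bool b < i \<and> i < 2 * c + a \<and> x = v \<otimes> u i) \<or>
    (b \<and> 2 \<le> a \<and> (\<exists>v. half c False a v \<and> x = v \<otimes> (u (2 * c + 1) \<otimes> D c)))"

lemma straightens_half: "half c b a x \<Longrightarrow> straightens c b a x"
  unfolding straightens_def using one_Z half_closed[of c b a x]
  by (intro disjI1 bexI[of _ \<one>] exI[of _ x]) simp_all

lemma straightens_scalar: "half c b a v \<Longrightarrow> z \<in> Z \<Longrightarrow> straightens c b a (z \<otimes> v)"
  unfolding straightens_def by blast

lemma straightens_flip: "half c True a x \<Longrightarrow> straightens c b a x"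
  using half_decorated[of c True a x] straightens_half[of c True a x]
  by (cases b) (auto simp: straightens_def)

lemma straightens_away:
  assumes "straightens c b a x"
  shows "straightens c b (Suc a) x"
  using assms unfolding straightens_def[of c b a]
proof (elim disjE conjE exE bexE)
  fix z v
  assume "z \<in> Z" "half c b a v" "x = z \<otimes> v"
  then show ?thesis using straightens_scalar[OF half.away] by simp
next
  fix v i
  assume "half c b a v" "2 * c + of_bool b < i" "i < 2 * c + a" "x = v \<otimes> u i"
  then show ?thesis
    unfolding straightens_def
    by (intro disjI2[OF disjI2[OF disjI1]] exI[of _ v] exI[of _ i]) (auto intro: half.away)
qed (auto simp: straightens_def intro: half.away)

lemma straightens_decorate:
  assumes "straightens c False 0 x"
  shows "straightens c True 1 (x \<otimes> D c)"
proof -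
  obtain z v where "z \<in> Z" "half c False 0 v" "x = z \<otimes> v"
    using assms unfolding straightens_def by auto
  then show ?thesis
    using straightens_scalar[OF half.decorate[of c v], of z]
    by (simp add: m_assoc Z_closed half_closed)
qed

text \<open>The arc of this step belongs to the rightmost line. A joining letter to the left of this line slides
past the arc; a joining letter on the last two lines is straightened by it to a \<open>T\<close> of one letter less,
which by \<open>half_close\<close> gives a half-diagram, and the arc of the step turns into a new line, decorated
if the decoration was below the joining letter.\<close>

lemma straightens_toward:
  assumes "straightens c b (Suc a) x" and n: "2 * c + a + 1 < n"
  shows "straightens (Suc c) (b \<and> 0 < a) a (x \<otimes> T (2 * c + a + 1))"
  using assms(1) unfolding straightens_def[of c]
proof (elim disjE conjE exE bexE)
  fix z v assume "z \<in> Z" "half c b (Suc a) v" "x = z \<otimes> v"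
  then show ?thesis
    using straightens_scalar[OF half.toward[of c b a v], of z]
    by (simp add: m_assoc Z_closed half_closed del: T.simps)
next
  assume b: "\<not> b" and x: "half c True (Suc a) x"
  from half.toward[OF x] show ?thesis
    using b straightens_half straightens_flip by (cases "a = 0") auto
next
  fix v i
  assume v: "half c b (Suc a) v" and i: "2 * c + of_bool b < i" "i < 2 * c + Suc a"
    and x: "x = v \<otimes> u i"
  show ?thesis
  proof (cases "i = 2 * c + a")
    case True
    then obtain a' where a: "a = Suc a'" using i by (cases a) auto
    have "half (Suc c) (b \<and> 0 < a) a (v \<otimes> T i)"
      using half.away[OF half_close[OF v, of i]] i n True a by (cases b) auto
    moreover have "x \<otimes> T (2 * c + a + 1) = v \<otimes> T i"
      using True n i u_T_adjacent[of i] half_closed[OF v] x by (simp add: m_assoc del: T.simps)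
    ultimately show ?thesis using straightens_half by simp
  next
    case False
    then have "x \<otimes> T (2 * c + a + 1) = v \<otimes> T (2 * c + a + 1) \<otimes> u (i + 2)"
      using n i u_T_shift[of i "2 * c + a + 1"] half_closed[OF v] x
      by (simp add: m_assoc del: T.simps)
    moreover have "2 * Suc c + of_bool (b \<and> 0 < a) < i + 2" "i + 2 < 2 * Suc c + a"
      using i False by (auto split: if_splits)
    ultimately show ?thesis
      using half.toward[OF v] unfolding straightens_def by blast
  qed
next
  fix v assume b: b and a: "2 \<le> Suc a" and v: "half c False (Suc a) v"
    and x: "x = v \<otimes> (u (2 * c + 1) \<otimes> D c)"
  have "x \<otimes> T (2 * c + a + 1) = v \<otimes> (u (2 * c + 1) \<otimes> (D c \<otimes> T (2 * c + a + 1)))"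
    using half_closed[OF v] x by (simp add: m_assoc del: T.simps)
  also have "\<dots> = v \<otimes> ((u (2 * c + 1) \<otimes> T (2 * c + a + 1)) \<otimes> D (Suc c))"
    using n a D_T[of c "2 * c + a + 1"] by (simp add: m_assoc del: T.simps D.simps)
  finally have x': "x \<otimes> T (2 * c + a + 1) =
      v \<otimes> ((u (2 * c + 1) \<otimes> T (2 * c + a + 1)) \<otimes> D (Suc c))" .
  show ?thesis
  proof (cases "a = 1")
    case True
    have "half (Suc c) False 0 (v \<otimes> T (2 * c + 1))"
      using half_close[OF v, of "2 * c + 1"] True n by (auto simp del: T.simps)
    then have "half (Suc c) True 1 (v \<otimes> T (2 * c + 1) \<otimes> D (Suc c))"
      by (rule half.decorate)
    moreover have "u (2 * c + 1) \<otimes> T (2 * c + a + 1) = T (2 * c + 1)"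
      using True n u_T_adjacent[of "2 * c + 1"] by (simp del: T.simps)
    ultimately show ?thesis
      using x' True b half_closed[OF v] straightens_half by (simp only: m_assoc T_closed D_closed) simp
  next
    case False
    have "u (2 * c + 1) \<otimes> T (2 * c + a + 1) = T (2 * c + a + 1) \<otimes> u (2 * Suc c + 1)"
      using False a n u_T_shift[of "2 * c + 1" "2 * c + a + 1"] by (simp del: T.simps)
    then have "x \<otimes> T (2 * c + a + 1) =
        v \<otimes> T (2 * c + a + 1) \<otimes> (u (2 * Suc c + 1) \<otimes> D (Suc c))"
      unfolding x' using half_closed[OF v] by (simp only: m_assoc T_closed D_closed u_closed m_closed)
    then show ?thesis
      using half.toward[OF v] a b False unfolding straightens_def by auto
  qed
qed

text \<open>The letter \<open>u i\<close> commutes with everything before the last two steps of a walk to level \<open>i + 1\<close>. Two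
steps away leave \<open>u i\<close> as a joining letter. A step away and back draws an arc at \<open>i, i + 1\<close>, which
\<open>u i\<close> closes to a circle. A step towards 0 and away again becomes a step away and back. Two steps
towards 0 draw an arc inside an arc, which \<open>u i\<close> turns into two arcs side by side; the left one is
dealt with by \<open>half_close\<close>.\<close>

lemma half_last_u:
  assumes "half c b a v" and "2 * c + a = Suc i" and "1 \<le> i" and "Suc i \<le> n"
  shows "straightens c b a (u i \<otimes> v)"
  using assms(1)
proof (cases rule: half.cases)
  case start
  then show ?thesis using assms by simp
next
  case (away a')
  from away(2) show ?thesis
  proof (cases rule: half.cases)
    case start
    then show ?thesis using assms away by simp
  next
    case (away a'')
    have "u i \<otimes> v = v \<otimes> u i"
      using half_commute[OF away(2)] assms \<open>a = Suc a'\<close> away by simp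
    moreover have "b \<Longrightarrow> 0 < a''" using half_decorated[OF away(2)] by simp
    ultimately show ?thesis
      using assms \<open>a = Suc a'\<close> away unfolding straightens_def
      by (intro disjI2[OF disjI2[OF disjI1]] exI[of _ v] exI[of _ i]) auto
  next
    case (decorate v')
    have v': "half c False 0 v'" by fact
    have "u i \<otimes> v = v' \<otimes> (u i \<otimes> D c)"
      using half_commute[OF v', of i] half_closed[OF v'] assms \<open>a = Suc a'\<close> decorate
      by (simp add: m_assoc[symmetric])
    moreover have "i = 2 * c + 1" using assms \<open>a = Suc a'\<close> decorate by simp
    ultimately show ?thesis
      using half.away[OF half.away[OF v']] \<open>a = Suc a'\<close> decorate unfolding straightens_def by auto
  next
    case (toward c' b' v')
    have v': "half c' b' (Suc a') v'" by fact
    have i: "i = Suc (2 * c' + a' + 1)" using assms \<open>a = Suc a'\<close> toward by simp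
    have "u i \<otimes> v = v' \<otimes> (u i \<otimes> T (2 * c' + a' + 1))"
      using half_commute[OF v', of i] half_closed[OF v'] assms i toward
      by (simp add: m_assoc[symmetric])
    then have "u i \<otimes> v = v' \<otimes> T (2 * c' + a + 1)" using i \<open>a = Suc a'\<close> by simp
    then have "half c b' a (u i \<otimes> v)"
      using half.toward[OF half.away[OF v']] \<open>a = Suc a'\<close> toward by simp
    then show ?thesis using toward straightens_half straightens_flip by (cases b'; cases "0 < a'") auto
  qed
next
  case (decorate v0)
  have "half c False 0 v0" by fact
  then show ?thesis
  proof (cases rule: half.cases)
    case start
    then show ?thesis using assms decorate by simp
  next
    case decorate
    then show ?thesis by simp
  next
    case (toward c' b' v')
    have v': "half c' b' 1 v'" using toward by simp
    have i: "i = Suc (2 * c' + 1)" using assms toward decorate by simp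
    have "u i \<otimes> v = v' \<otimes> ((u i \<otimes> T (2 * c' + 1)) \<otimes> D c)"
      using half_commute[OF v', of i] half_closed[OF v'] assms i toward decorate
      by (simp add: m_assoc[symmetric] del: T.simps D.simps)
    also have "u i \<otimes> T (2 * c' + 1) = T (2 * c' + 2)" using i by simp
    also have "v' \<otimes> (T (2 * c' + 2) \<otimes> D c) = v' \<otimes> D c' \<otimes> T (2 * c' + 2)"
      using D_T[of c' "2 * c' + 2"] half_closed[OF v'] toward i assms
      by (simp add: m_assoc del: T.simps D.simps)
    finally have uv: "u i \<otimes> v = v' \<otimes> D c' \<otimes> T (2 * c' + 2)" .
    have "straightens c' True 1 (v' \<otimes> D c')"
    proof (cases b')
      case True
      then show ?thesis
        using half_decorate_twice[OF v'] straightens_scalar[of c' True 1 v' \<delta>] v' \<delta>_Z assms i by simp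
    next
      case False
      then show ?thesis
        using half_decorate_first[OF v'] straightens_half assms i by simp
    qed
    \<comment> \<open>the steps 1, 0, 1 have become 1, 2, 1, with one more decoration on the line\<close>
    from straightens_toward[OF straightens_away[OF this]] show ?thesis
      using uv assms i toward decorate by (simp del: T.simps D.simps)
  qed
next
  case (toward c0 b0 v0)
  have i: "i = 2 * c0 + a + 1" using assms toward by simp
  from toward(4) show ?thesis
  proof (cases rule: half.cases)
    case away
    have v0: "half c0 b0 a v0" using away by simp
    have "u i \<otimes> v = v0 \<otimes> (u i \<otimes> T i)"
      using half_commute[OF v0, of i] half_closed[OF v0] assms i toward
      by (simp add: m_assoc[symmetric] del: T.simps)
    also have "\<dots> = d \<otimes> v"
      using u_T_same[of i] Z_left_commute[OF d_Z] half_closed[OF v0] assms i toward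
      by (simp del: T.simps)
    finally show ?thesis using straightens_scalar[OF assms(1) d_Z] by simp
  next
    case (decorate v1)
    have v1: "half c0 False 0 v1" using decorate by simp
    obtain y where y: "y \<in> carrier G" "v1 = y \<otimes> Cups c0"
      using half_Cups[OF v1] assms i by auto
    have a: "a = 0" using decorate by simp
    have "u i \<otimes> v = v1 \<otimes> (u i \<otimes> (D c0 \<otimes> T i))"
      using half_commute[OF v1, of i] half_closed[OF v1] assms i toward decorate
      by (simp add: m_assoc[symmetric] del: T.simps)
    also have "\<dots> = y \<otimes> (Cups (Suc c0) \<otimes> (D c0 \<otimes> T i))"
      using y i a by (simp add: m_assoc del: T.simps)
    also have "\<dots> = \<gamma> \<otimes> (v1 \<otimes> T i)"
      using y i a assms Cups_D_T[of c0] Cups_T_top[of c0] Z_left_commute[OF \<gamma>_Z]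
      by (simp add: m_assoc del: T.simps Cups.simps)
    finally have "u i \<otimes> v = \<gamma> \<otimes> (v1 \<otimes> T i)" .
    moreover have "half c b a (v1 \<otimes> T i)"
      using half.toward[OF half.away[OF v1]] i toward decorate by (simp del: T.simps)
    ultimately show ?thesis using straightens_scalar \<gamma>_Z by simp
  next
    case (toward c1 b1 v1)
    have v1: "half c1 b1 (a + 2) v1" using toward by simp
    have c: "c0 = Suc c1" "v0 = v1 \<otimes> T (i - 1)" "b0 = b1"
      using toward i by auto
    have "u i \<otimes> v = v1 \<otimes> ((u i \<otimes> T (i - 1)) \<otimes> T i)"
      using half_commute[OF v1, of i] half_closed[OF v1] assms i c \<open>v = v0 \<otimes> T (2 * c0 + a + 1)\<close>
      by (simp add: m_assoc[symmetric] del: T.simps)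
    also have "u i \<otimes> T (i - 1) = T i" using assms by (cases i) auto
    also have "T i \<otimes> T i = T (i - 2) \<otimes> T i"
      using T_T[of "i - 2" i] assms i c by (simp del: T.simps)
    finally have uv: "u i \<otimes> v = v1 \<otimes> T (i - 2) \<otimes> T i"
      using half_closed[OF v1] by (simp add: m_assoc del: T.simps)
    have "half (Suc c1) (b1 \<and> 0 < a) a (v1 \<otimes> T (i - 2))"
      using half_close[OF v1, of "i - 2"] assms i c by (simp add: numeral_eq_Suc del: T.simps)
    from half.toward[OF half.away[OF this]] have "half c b a (u i \<otimes> v)"
      using uv c i \<open>c = Suc c0\<close> \<open>b = (b0 \<and> 0 < a)\<close> by (cases b1) (simp_all del: T.simps)
    then show ?thesis by (rule straightens_half)
  qed
qed

text \<open>The steps after level \<open>i + 1\<close> are harmless because straightening is stable under them.\<close>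

lemma u_half:
  "half c b a v \<Longrightarrow> 1 \<le> i \<Longrightarrow> i < 2 * c + a \<Longrightarrow> 2 * c + a \<le> n \<Longrightarrow>
    straightens c b a (u i \<otimes> v)"
proof (induction rule: half.induct)
  case (away c b a v)
  then show ?case
    using half_last_u[OF half.away[OF away.hyps], of i] straightens_away[of c b a]
    by (cases "i = 2 * c + a") auto
next
  case (decorate c v)
  then show ?case
    using half_last_u[OF half.decorate[OF decorate.hyps], of i] straightens_decorate[of c "u i \<otimes> v"]
      half_closed[OF decorate.hyps]
    by (cases "i = 2 * c") (auto simp: m_assoc)
next
  case (toward c b a v)
  then show ?case
    using half_last_u[OF half.toward[OF toward.hyps], of i] straightens_toward[of c b a "u i \<otimes> v"]
      half_closed[OF toward.hyps]
    by (cases "i = 2 * c + a + 1") (auto simp: m_assoc simp del: T.simps)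
qed auto

text \<open>Only the first edge of the walk matters: the letter \<open>e\<close> there gives the scalar \<open>\<delta>\<close>, while an
undecorated first edge becomes the decorated one and flips the walk up to its return to weight 0.\<close>

lemma e_half:
  "half c b a v \<Longrightarrow> 1 \<le> 2 * c + a \<Longrightarrow> 2 * c + a \<le> n \<Longrightarrow> straightens c b a (e \<otimes> v)"
proof (induction rule: half.induct)
  case (away c b a v)
  show ?case
  proof (cases "2 * c + a = 0")
    case True
    from away.hyps True have "v = \<one> \<and> \<not> b" by (cases rule: half.cases) auto
    then show ?thesis
      using half.decorate[OF half.start] straightens_flip True by simp
  next
    case False
    then show ?thesis using away straightens_away by auto
  qed
next
  case (decorate c v)
  have v: "v \<in> carrier G" by (rule half_closed) fact
  show ?case
  proof (cases "c = 0")
    case True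
    have "v = \<one>" using decorate.hyps by (cases rule: half.cases) (use True in auto)
    then have "e \<otimes> (v \<otimes> D c) = \<delta> \<otimes> (\<one> \<otimes> D 0)" using True e_square by simp
    then show ?thesis
      using straightens_scalar[OF half.decorate[OF half.start] \<delta>_Z] True by simp
  next
    case False
    then show ?thesis
      using decorate straightens_decorate[of c "e \<otimes> v"] v by (simp add: m_assoc)
  qed
next
  case (toward c b a v)
  then show ?case
    using straightens_toward[of c b a "e \<otimes> v"] half_closed[OF toward.hyps]
    by (simp add: m_assoc del: T.simps)
qed auto

text \<open>The cofactor is \<open>U\<^sub>2 U\<^sub>3 \<cdots> U\<^sub>i\<close>.\<close>

lemma u_eq_T_mult: "1 \<le> i \<Longrightarrow> i < n \<Longrightarrow> \<exists>r\<in>carrier G. u i = T i \<otimes> r"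
proof (induction i rule: nat_induct_at_least)
  case base
  show ?case by (intro bexI[of _ \<one>]) simp_all
next
  case (Suc i)
  then obtain r where r: "r \<in> carrier G" "u i = T i \<otimes> r" by auto
  have "u (Suc i) = u (Suc i) \<otimes> (u i \<otimes> u (Suc i))"
    using u_braid_down[of i] Suc.hyps Suc.prems by simp
  also have "\<dots> = T (Suc i) \<otimes> (r \<otimes> u (Suc i))"
    using r by (simp add: m_assoc)
  finally show ?case using r by (intro bexI[of _ "r \<otimes> u (Suc i)"]) simp_all
qed

text \<open>A letter that joins two lines creates one more arc at the bottom; up to a factor on the right, this
arc can be moved to the far left, where it extends the standard pattern.\<close>

lemma half_u_Cups:
  assumes v: "half c b a v" and n: "2 * c + a \<le> n" and i: "2 * c < i" "i < n"
  shows "\<exists>y\<in>carrier G. \<exists>y'\<in>carrier G. v \<otimes> u i = y \<otimes> (Cups (Suc c) \<otimes> y')"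
proof -
  obtain y where y: "y \<in> carrier G" "v = y \<otimes> Cups c" using half_Cups[OF v n] by blast
  obtain r where r: "r \<in> carrier G" "u i = T i \<otimes> r" using u_eq_T_mult[of i] i by auto
  obtain t where t: "t \<in> carrier G" "Cups c \<otimes> T i = t \<otimes> Cups (Suc c)" using Cups_T[of i] i by auto
  have "v \<otimes> u i = y \<otimes> ((Cups c \<otimes> T i) \<otimes> r)"
    using y r by (simp add: m_assoc)
  also have "\<dots> = (y \<otimes> t) \<otimes> (Cups (Suc c) \<otimes> r)"
    using y r t by (simp add: m_assoc del: Cups.simps)
  finally show ?thesis using y r t by blast
qed

text \<open>Both kinds of joined lines factor through one more standard arc, so that they lie in the two-sided
ideal that this pattern of arcs generates.\<close>

lemma straightens_cases [consumes 2]: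
  assumes "straightens c b a x" and n: "2 * c + a \<le> n"
  obtains (scalar) z v where "z \<in> Z" "half c b a v" "x = z \<otimes> v"
  | (flip) "\<not> b" "0 < a" "half c True a x"
  | (cups) y y' where "2 \<le> a" "y \<in> carrier G" "y' \<in> carrier G" "x = y \<otimes> (Cups (Suc c) \<otimes> y')"
proof -
  have ?thesis if "half c b a v" "2 * c + of_bool b < i" "i < 2 * c + a" "x = v \<otimes> u i" for v i
  proof -
    have "2 \<le> a" using that by simp
    moreover have "2 * c < i" "i < n" using that n by auto
    ultimately show ?thesis
      using half_u_Cups[OF that(1) n, of i] that(4) cups by blast
  qed
  moreover have ?thesis
    if a: "2 \<le> a" and v: "half c False a v" and x: "x = v \<otimes> (u (2 * c + 1) \<otimes> D c)" for v
  proof -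
    obtain y y' where y: "y \<in> carrier G" "y' \<in> carrier G" "v \<otimes> u (2 * c + 1) = y \<otimes> (Cups (Suc c) \<otimes> y')"
      using half_u_Cups[OF v n, of "2 * c + 1"] a n by auto
    have "x = (v \<otimes> u (2 * c + 1)) \<otimes> D c"
      using x half_closed[OF v] by (simp add: m_assoc)
    also have "\<dots> = y \<otimes> (Cups (Suc c) \<otimes> (y' \<otimes> D c))"
      unfolding y(3) using y(1,2) by (simp add: m_assoc del: Cups.simps)
    finally show ?thesis using cups[OF a y(1), of "y' \<otimes> D c"] y by simp
  qed
  ultimately show ?thesis
    using assms(1) scalar flip unfolding straightens_def by blast
qed

end

section \<open>Spans and left ideals in an algebra with central scalars\<close>

text \<open>A ring with a multiplication by scalars that is given by multiplication with the central elements
\<open>c \<odot> \<one>\<close>. All closure properties of left ideals and submodules under scalars reduce to this.\<close>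

locale scalar_ring = ring A for A :: "('k::comm_ring_1, 'a) module" (structure) +
  assumes scalar_closed [simp]: "c \<odot> \<one> \<in> carrier A"
    and smult_eq_mult: "v \<in> carrier A \<Longrightarrow> c \<odot> v = (c \<odot> \<one>) \<otimes> v"
    and scalar_central: "v \<in> carrier A \<Longrightarrow> v \<otimes> (c \<odot> \<one>) = (c \<odot> \<one>) \<otimes> v"
    and one_smult: "1 \<odot> \<one> = \<one>"
begin

lemma smult_closed: "v \<in> carrier A \<Longrightarrow> c \<odot> v \<in> carrier A"
  by (subst smult_eq_mult) simp_all

lemma left_ideal_smult:
  assumes "left_ideal J A" "v \<in> J"
  shows "c \<odot> v \<in> J"
proof -
  have "v \<in> carrier A"
    using assms additive_subgroup.a_Hcarr by (fastforce simp: left_ideal_def)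
  then show ?thesis
    using assms scalar_closed[of c] unfolding smult_eq_mult[of v c, OF \<open>v \<in> carrier A\<close>]
    by (simp add: left_ideal_def)
qed

lemma submodule_iff:
  "submodule V (ring_of_type_algebra :: 'k ring) A \<longleftrightarrow>
    additive_subgroup V A \<and> (\<forall>c. \<forall>v\<in>V. c \<odot> v \<in> V)"
  by (auto simp: submodule_def submodule_axioms_def additive_subgroup_def ring_of_type_algebra_def)

lemma additive_subgroup_carrier: "additive_subgroup (carrier A) A"
  by (meson add.subgroup_self additive_subgroup.intro)

lemma additive_subgroup_Inter:
  assumes "\<And>H. H \<in> F \<Longrightarrow> additive_subgroup H A" "F \<noteq> {}"
  shows "additive_subgroup (\<Inter>F) A"
  using add.subgroups_Inter[of F] assms
  by (auto simp: additive_subgroup_def)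

lemma submodule_lin_span:
  assumes "S \<subseteq> carrier A"
  shows "submodule (lin_span A S) (ring_of_type_algebra :: 'k ring) A"
proof -
  let ?F = "{V. submodule V (ring_of_type_algebra :: 'k ring) A \<and> S \<subseteq> V}"
  have "carrier A \<in> ?F"
    using assms additive_subgroup_carrier smult_closed by (auto simp: submodule_iff)
  then show ?thesis
    unfolding lin_span_def hull_def submodule_iff
    by (intro conjI additive_subgroup_Inter) (auto simp: submodule_iff)
qed

lemma lin_span_superset: "S \<subseteq> lin_span A S"
  unfolding lin_span_def by (rule hull_subset)

lemma lin_span_minimal:
  "submodule V (ring_of_type_algebra :: 'k ring) A \<Longrightarrow> S \<subseteq> V \<Longrightarrow> lin_span A S \<subseteq> V"
  unfolding lin_span_def by (rule hull_minimal)

lemma left_ideal_left_ideal_gen: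
  assumes "S \<subseteq> carrier A"
  shows "left_ideal (left_ideal_gen A S) A"
proof -
  let ?F = "{J. left_ideal J A \<and> S \<subseteq> J}"
  have "carrier A \<in> ?F"
    using assms additive_subgroup_carrier by (auto simp: left_ideal_def)
  then show ?thesis
    unfolding left_ideal_gen_def hull_def left_ideal_def
    by (intro conjI additive_subgroup_Inter) (auto simp: left_ideal_def)
qed

lemma left_ideal_gen_superset: "S \<subseteq> left_ideal_gen A S"
  unfolding left_ideal_gen_def by (rule hull_subset)

lemma left_ideal_gen_minimal: "left_ideal J A \<Longrightarrow> S \<subseteq> J \<Longrightarrow> left_ideal_gen A S \<subseteq> J"
  unfolding left_ideal_gen_def by (rule hull_minimal)

lemma ideal_left_ideal: "ideal J A \<Longrightarrow> left_ideal J A"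
  by (simp add: left_ideal_def ideal.axioms(1) ideal.I_l_closed)

lemma left_ideal_carrier: "left_ideal J A \<Longrightarrow> J \<subseteq> carrier A"
  by (auto simp: left_ideal_def dest: additive_subgroup.a_subset)

lemma set_add_iff: "v \<in> H <+>\<^bsub>A\<^esub> K \<longleftrightarrow> (\<exists>h\<in>H. \<exists>k\<in>K. v = h \<oplus> k)"
  by (auto simp: set_add_def')

lemma left_ideal_add:
  assumes "left_ideal J A" "left_ideal K A"
  shows "left_ideal (J <+>\<^bsub>A\<^esub> K) A"
  unfolding left_ideal_def
proof (intro conjI ballI)
  show "additive_subgroup (J <+>\<^bsub>A\<^esub> K) A"
    using assms by (simp add: left_ideal_def add_additive_subgroups)
  fix a x assume "a \<in> carrier A" "x \<in> J <+>\<^bsub>A\<^esub> K"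
  then show "a \<otimes> x \<in> J <+>\<^bsub>A\<^esub> K"
    using assms assms[THEN left_ideal_carrier]
    by (fastforce simp: set_add_iff left_ideal_def r_distr subset_iff)
qed

lemma set_add_left:
  assumes "additive_subgroup K A" "H \<subseteq> carrier A"
  shows "H \<subseteq> H <+>\<^bsub>A\<^esub> K"
proof
  fix h assume "h \<in> H"
  with assms have "h = h \<oplus> \<zero>" by auto
  with \<open>h \<in> H\<close> show "h \<in> H <+>\<^bsub>A\<^esub> K"
    using additive_subgroup.zero_closed[OF assms(1)] unfolding set_add_iff by blast
qed

lemma set_add_right:
  assumes "additive_subgroup H A" "K \<subseteq> carrier A"
  shows "K \<subseteq> H <+>\<^bsub>A\<^esub> K"
proof
  fix k assume "k \<in> K"
  with assms have "k = \<zero> \<oplus> k" by auto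
  with \<open>k \<in> K\<close> show "k \<in> H <+>\<^bsub>A\<^esub> K"
    using additive_subgroup.zero_closed[OF assms(1)] unfolding set_add_iff by blast
qed

lemma smult_add:
  assumes "v \<in> carrier A" "w \<in> carrier A"
  shows "c \<odot> (v \<oplus> w) = c \<odot> v \<oplus> c \<odot> w"
  using assms by (simp add: smult_eq_mult[of "v \<oplus> w"] smult_eq_mult[of v] smult_eq_mult[of w] r_distr)

lemma smult_mult:
  assumes "v \<in> carrier A" "w \<in> carrier A"
  shows "(c \<odot> v) \<otimes> w = c \<odot> (v \<otimes> w)"
  using assms by (simp add: smult_eq_mult[of v] smult_eq_mult[of "v \<otimes> w"] m_assoc)

lemma mult_smult:
  assumes "v \<in> carrier A" "w \<in> carrier A"
  shows "v \<otimes> (c \<odot> w) = c \<odot> (v \<otimes> w)"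
  using assms scalar_central[of v c]
  by (simp add: smult_eq_mult[of w] smult_eq_mult[of "v \<otimes> w"] m_assoc[symmetric])

text \<open>It suffices to test left multiplication by a generating set \<open>G\<close> on the spanning set \<open>S\<close>: for a fixed
\<open>g\<close>, the elements that \<open>g\<close> sends into the sum form a submodule. The first assumption expresses
that \<open>G\<close> generates the algebra.\<close>

lemma left_ideal_lin_span_add:
  assumes generate: "\<And>Q. additive_subgroup Q A \<Longrightarrow> (\<And>c v. v \<in> Q \<Longrightarrow> c \<odot> v \<in> Q) \<Longrightarrow>
      (\<And>g v. g \<in> G \<Longrightarrow> v \<in> Q \<Longrightarrow> g \<otimes> v \<in> Q) \<Longrightarrow> left_ideal Q A"
    and G: "G \<subseteq> carrier A" and J: "left_ideal J A" and S: "S \<subseteq> carrier A"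
    and closed: "\<And>g s. g \<in> G \<Longrightarrow> s \<in> S \<Longrightarrow> g \<otimes> s \<in> lin_span A S <+>\<^bsub>A\<^esub> J"
  shows "left_ideal (lin_span A S <+>\<^bsub>A\<^esub> J) A"
proof -
  let ?V = "lin_span A S" and ?Q = "lin_span A S <+>\<^bsub>A\<^esub> J"
  have V: "additive_subgroup ?V A" "\<And>c v. v \<in> ?V \<Longrightarrow> c \<odot> v \<in> ?V"
    using submodule_lin_span[OF S] by (auto simp: submodule_iff)
  have J': "additive_subgroup J A" using J by (simp add: left_ideal_def)
  have Q: "additive_subgroup ?Q A" by (rule add_additive_subgroups[OF V(1) J'])
  have carriers: "?V \<subseteq> carrier A" "J \<subseteq> carrier A" "?Q \<subseteq> carrier A"
    using V(1) J' Q additive_subgroup.a_subset by auto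
  have smult: "c \<odot> v \<in> ?Q" if v: "v \<in> ?Q" for c v
  proof -
    obtain x y where xy: "x \<in> ?V" "y \<in> J" "v = x \<oplus> y" using v unfolding set_add_iff by blast
    then have "c \<odot> v = c \<odot> x \<oplus> c \<odot> y" using carriers by (auto intro: smult_add)
    then show ?thesis
      using xy V(2)[of x c] left_ideal_smult[OF J, of y c] unfolding set_add_iff by blast
  qed
  have span: "g \<otimes> v \<in> ?Q" if g: "g \<in> G" and v: "v \<in> ?V" for g v
  proof -
    have gc: "g \<in> carrier A" using g G by auto
    have "submodule {v \<in> carrier A. g \<otimes> v \<in> ?Q} (ring_of_type_algebra :: 'k ring) A"
      unfolding submodule_iff
    proof (intro conjI allI ballI)
      show "additive_subgroup {v \<in> carrier A. g \<otimes> v \<in> ?Q} A"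
      proof (intro additive_subgroup.intro add.subgroupI)
        show "{v \<in> carrier A. g \<otimes> v \<in> ?Q} \<noteq> {}"
          using gc additive_subgroup.zero_closed[OF Q] by (auto intro!: exI[of _ \<zero>])
      next
        fix v assume "v \<in> {v \<in> carrier A. g \<otimes> v \<in> ?Q}"
        then show "\<ominus> v \<in> {v \<in> carrier A. g \<otimes> v \<in> ?Q}"
          using gc additive_subgroup.a_inv_closed[OF Q] by (simp add: r_minus)
      next
        fix v w assume "v \<in> {v \<in> carrier A. g \<otimes> v \<in> ?Q}" "w \<in> {v \<in> carrier A. g \<otimes> v \<in> ?Q}"
        then show "v \<oplus> w \<in> {v \<in> carrier A. g \<otimes> v \<in> ?Q}"
          using gc additive_subgroup.a_closed[OF Q] by (simp add: r_distr)
      qed auto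
    next
      fix c v assume "v \<in> {v \<in> carrier A. g \<otimes> v \<in> ?Q}"
      then show "c \<odot> v \<in> {v \<in> carrier A. g \<otimes> v \<in> ?Q}"
        using gc by (simp add: smult_closed mult_smult smult)
    qed
    from lin_span_minimal[OF this] show ?thesis using closed[OF g] S v by blast
  qed
  show ?thesis
  proof (rule generate[OF Q smult])
    fix g v assume g: "g \<in> G" and v: "v \<in> ?Q"
    have gc: "g \<in> carrier A" using g G by auto
    obtain x y where xy: "x \<in> ?V" "y \<in> J" "v = x \<oplus> y" using v unfolding set_add_iff by blast
    then have "g \<otimes> v = g \<otimes> x \<oplus> g \<otimes> y" using gc carriers by (auto intro: r_distr)
    moreover have "g \<otimes> y \<in> ?Q"
      using J gc xy(2) set_add_right[OF V(1) carriers(2)] by (auto simp: left_ideal_def)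
    ultimately show "g \<otimes> v \<in> ?Q"
      using span[OF g xy(1)] additive_subgroup.a_closed[OF Q] by simp
  qed
qed

end

section \<open>Quotients of monoid algebras and extension of scalars\<close>

lemma quotient_algebra_carrier:
  "carrier (quotient_algebra A I) = {I +>\<^bsub>A\<^esub> a | a. a \<in> carrier A}"
  by (auto simp: quotient_algebra_def ring.defs FactRing_simps)

lemma quotient_algebra_one: "\<one>\<^bsub>quotient_algebra A I\<^esub> = I +>\<^bsub>A\<^esub> \<one>\<^bsub>A\<^esub>"
  by (simp add: quotient_algebra_def ring.defs FactRing_simps)

lemma quotient_algebra_mult:
  assumes "ideal I A" "a \<in> carrier A" "b \<in> carrier A"
  shows "(I +>\<^bsub>A\<^esub> a) \<otimes>\<^bsub>quotient_algebra A I\<^esub> (I +>\<^bsub>A\<^esub> b) = I +>\<^bsub>A\<^esub> (a \<otimes>\<^bsub>A\<^esub> b)"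
  using ideal.rcoset_mult_add[OF assms] by (simp add: quotient_algebra_def ring.defs FactRing_simps)

lemma quotient_algebra_add:
  assumes "ideal I A" "a \<in> carrier A" "b \<in> carrier A"
  shows "(I +>\<^bsub>A\<^esub> a) \<oplus>\<^bsub>quotient_algebra A I\<^esub> (I +>\<^bsub>A\<^esub> b) = I +>\<^bsub>A\<^esub> (a \<oplus>\<^bsub>A\<^esub> b)"
  using ideal.a_rcos_sum[OF assms] by (simp add: quotient_algebra_def ring.defs FactRing_simps)

lemma monoid_algebra_simps:
  "carrier (monoid_algebra M) = {f. Poly_Mapping.keys f \<subseteq> carrier M}"
  "f \<otimes>\<^bsub>monoid_algebra M\<^esub> g = convolution M f g"
  "\<one>\<^bsub>monoid_algebra M\<^esub> = Poly_Mapping.single \<one>\<^bsub>M\<^esub> 1"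
  "f \<oplus>\<^bsub>monoid_algebra M\<^esub> g = f + g"
  "\<zero>\<^bsub>monoid_algebra M\<^esub> = 0"
  "c \<odot>\<^bsub>monoid_algebra M\<^esub> f = Poly_Mapping.map ((*) c) f"
  by (simp_all add: monoid_algebra_def)

lemma map_times_single: "Poly_Mapping.map ((*) c) (Poly_Mapping.single a r) = Poly_Mapping.single a (c * r :: 'r::comm_ring_1)"
  by (rule poly_mapping_eqI) (simp add: lookup_smult lookup_single when_def)

lemma monoid_algebra_minus:
  assumes "monoid M" "f \<in> carrier (monoid_algebra M)" "g \<in> carrier (monoid_algebra M)"
  shows "f \<ominus>\<^bsub>monoid_algebra M\<^esub> g = f - (g :: _ \<Rightarrow>\<^sub>0 'r::comm_ring_1)"
proof -
  interpret ring "monoid_algebra M :: ('r, _) module" by (rule monoid_algebra_ring) fact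
  have "\<ominus>\<^bsub>monoid_algebra M\<^esub> g = - g"
    using assms by (intro minus_equality) (auto simp: monoid_algebra_simps in_keys_iff)
  then show ?thesis by (simp add: a_minus_def monoid_algebra_simps)
qed

lemma monoid_algebra_induct [consumes 1, case_names zero single add]:
  assumes "f \<in> carrier (monoid_algebra M)"
    and "P 0"
    and "\<And>a r. a \<in> carrier M \<Longrightarrow> P (Poly_Mapping.single a r)"
    and "\<And>f g. f \<in> carrier (monoid_algebra M) \<Longrightarrow> g \<in> carrier (monoid_algebra M) \<Longrightarrow>
      P f \<Longrightarrow> P g \<Longrightarrow> P (f + g)"
  shows "P (f :: _ \<Rightarrow>\<^sub>0 'r::comm_ring_1)"
proof -
  have "P (\<Sum>a\<in>A. Poly_Mapping.single a (Poly_Mapping.lookup f a)) \<and>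
      (\<Sum>a\<in>A. Poly_Mapping.single a (Poly_Mapping.lookup f a)) \<in> carrier (monoid_algebra M)"
    if "finite A" "A \<subseteq> carrier M" for A
    using that
  proof (induction A)
    case empty
    then show ?case using assms(2) by (simp add: monoid_algebra_simps)
  next
    case (insert a A)
    then have "Poly_Mapping.single a (Poly_Mapping.lookup f a) \<in> carrier (monoid_algebra M)"
      by (simp add: monoid_algebra_simps)
    moreover from this insert have "Poly_Mapping.single a (Poly_Mapping.lookup f a) +
        (\<Sum>a\<in>A. Poly_Mapping.single a (Poly_Mapping.lookup f a)) \<in> carrier (monoid_algebra M)"
      by (auto simp: monoid_algebra_simps dest!: subsetD[OF Poly_Mapping.keys_add])
    ultimately show ?case using insert assms(3,4) by simp
  qed
  from this[of "Poly_Mapping.keys f"] show ?thesis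
    using assms(1) poly_mapping_decomp[of f] by (simp add: monoid_algebra_simps)
qed

lemma quotient_algebra_scalar_ring:
  assumes M: "monoid M" and I: "ideal I (monoid_algebra M)"
  shows "scalar_ring (quotient_algebra (monoid_algebra M) I :: ('k::comm_ring_1, _) module)"
proof -
  let ?A = "monoid_algebra M :: ('k, _) module" and ?Q = "quotient_algebra (monoid_algebra M) I"
  interpret M: monoid M by fact
  interpret A: ring ?A by (rule monoid_algebra_ring) fact
  interpret Q: ring ?Q by (rule quotient_algebra_ring) fact
  have single: "Poly_Mapping.single \<one>\<^bsub>M\<^esub> c \<in> carrier ?A" for c :: 'k
    by (auto simp: monoid_algebra_simps)
  have smult: "c \<odot>\<^bsub>?Q\<^esub> (I +>\<^bsub>?A\<^esub> f) = I +>\<^bsub>?A\<^esub> (Poly_Mapping.single \<one>\<^bsub>M\<^esub> c \<otimes>\<^bsub>?A\<^esub> f)"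
    if "f \<in> carrier ?A" for c f
    using quotient_algebra_smult[OF M I that] monoid_algebra_smult[OF M that] by simp
  have scalar: "c \<odot>\<^bsub>?Q\<^esub> \<one>\<^bsub>?Q\<^esub> = I +>\<^bsub>?A\<^esub> Poly_Mapping.single \<one>\<^bsub>M\<^esub> c" for c
    using smult[OF A.one_closed] single[of c] by (simp add: quotient_algebra_one)
  have central: "f \<otimes>\<^bsub>?A\<^esub> Poly_Mapping.single \<one>\<^bsub>M\<^esub> c = Poly_Mapping.single \<one>\<^bsub>M\<^esub> c \<otimes>\<^bsub>?A\<^esub> f"
    if "f \<in> carrier ?A" for f c
    using that
  proof (induction rule: monoid_algebra_induct)
    case zero
    then show ?case by (simp add: monoid_algebra_simps convolution_def)
  next
    case (single a r)
    then show ?case by (simp add: monoid_algebra_simps convolution_single mult.commute)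
  next
    case (add f g)
    then show ?case by (simp add: monoid_algebra_simps convolution_add_left convolution_add_right)
  qed
  show ?thesis
  proof (intro scalar_ring.intro scalar_ring_axioms.intro Q.ring_axioms)
    show "c \<odot>\<^bsub>?Q\<^esub> \<one>\<^bsub>?Q\<^esub> \<in> carrier ?Q" for c
      unfolding scalar using single by (auto simp: quotient_algebra_carrier)
    show "1 \<odot>\<^bsub>?Q\<^esub> \<one>\<^bsub>?Q\<^esub> = \<one>\<^bsub>?Q\<^esub>"
      unfolding scalar by (simp add: quotient_algebra_one monoid_algebra_simps)
    fix v c assume "v \<in> carrier ?Q"
    then obtain f where f: "f \<in> carrier ?A" "v = I +>\<^bsub>?A\<^esub> f"
      by (auto simp: quotient_algebra_carrier)
    show "c \<odot>\<^bsub>?Q\<^esub> v = (c \<odot>\<^bsub>?Q\<^esub> \<one>\<^bsub>?Q\<^esub>) \<otimes>\<^bsub>?Q\<^esub> v"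
      unfolding scalar f(2) using f(1) single smult quotient_algebra_mult[OF I] by simp
    show "v \<otimes>\<^bsub>?Q\<^esub> (c \<odot>\<^bsub>?Q\<^esub> \<one>\<^bsub>?Q\<^esub>) = (c \<odot>\<^bsub>?Q\<^esub> \<one>\<^bsub>?Q\<^esub>) \<otimes>\<^bsub>?Q\<^esub> v"
      unfolding scalar f(2) using f(1) single central quotient_algebra_mult[OF I] by simp
  qed
qed

text \<open>In an extension of scalars, the elements \<open>1 \<otimes> a\<close> depend additively, multiplicatively and
\<open>\<phi>\<close>-linearly on \<open>a\<close>, and the sums of their multiples are all elements. For this it is enough that
the scalars act on the carrier.\<close>

locale scalar_extension = ring A for \<phi> :: "'r \<Rightarrow> 'k::comm_ring_1" and A :: "('r, 'a) module" (structure) +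
  assumes scaling_closed: "a \<in> carrier A \<Longrightarrow> c \<odot> a \<in> carrier A"
begin

abbreviation relation_ideal where
  "relation_ideal \<equiv> Idl\<^bsub>monoid_algebra A\<^esub> (scalar_relations \<phi> A)"

abbreviation B where "B \<equiv> extend_scalars \<phi> A"

lemma monoid_A: "monoid A" ..

sublocale MA: ring "monoid_algebra A :: ('k, _) module"
  by (rule monoid_algebra_ring[OF monoid_A])

lemma relations_carrier: "scalar_relations \<phi> A \<subseteq> carrier (monoid_algebra A)"
  using scaling_closed by (intro scalar_relations_carrier ring_axioms) auto

lemma relation_ideal: "ideal relation_ideal (monoid_algebra A)"
  by (intro MA.genideal_ideal relations_carrier)

sublocale B: scalar_ring B
  unfolding extend_scalars_def by (rule quotient_algebra_scalar_ring[OF monoid_A relation_ideal])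

lemma single_carrier: "a \<in> carrier A \<Longrightarrow> Poly_Mapping.single a c \<in> carrier (monoid_algebra A)"
  by (simp add: monoid_algebra_simps)

lemma one_tensor_closed: "a \<in> carrier A \<Longrightarrow> one_tensor \<phi> A a \<in> carrier B"
  unfolding one_tensor_def extend_scalars_def quotient_algebra_carrier
  using single_carrier by blast

lemma one_tensor_one: "one_tensor \<phi> A \<one> = \<one>\<^bsub>B\<^esub>"
  by (simp add: one_tensor_def extend_scalars_def quotient_algebra_one monoid_algebra_simps)

lemma one_tensor_mult:
  "a \<in> carrier A \<Longrightarrow> b \<in> carrier A \<Longrightarrow>
    one_tensor \<phi> A (a \<otimes> b) = one_tensor \<phi> A a \<otimes>\<^bsub>B\<^esub> one_tensor \<phi> A b"
  by (simp add: one_tensor_def extend_scalars_def single_carrier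
      quotient_algebra_mult[OF relation_ideal])
    (simp add: monoid_algebra_simps convolution_single)

lemma smult_one_tensor:
  "a \<in> carrier A \<Longrightarrow>
    c \<odot>\<^bsub>B\<^esub> one_tensor \<phi> A a = relation_ideal +>\<^bsub>monoid_algebra A\<^esub> Poly_Mapping.single a c"
  by (simp add: one_tensor_def extend_scalars_def single_carrier
      quotient_algebra_smult[OF monoid_A relation_ideal])
    (simp add: monoid_algebra_simps map_times_single)

lemma coset_eqI:
  assumes "f \<in> carrier (monoid_algebra A)" "g \<in> carrier (monoid_algebra A)"
    and "f - g \<in> scalar_relations \<phi> A"
  shows "relation_ideal +>\<^bsub>monoid_algebra A\<^esub> f = relation_ideal +>\<^bsub>monoid_algebra A\<^esub> g"
  using assms MA.quotient_eq_iff_same_a_r_cos[OF relation_ideal assms(1,2)]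
    monoid_algebra_minus[OF monoid_A assms(1,2)] MA.genideal_self[OF relations_carrier]
  by auto

lemma one_tensor_smult:
  assumes "a \<in> carrier A"
  shows "one_tensor \<phi> A (c \<odot> a) = \<phi> c \<odot>\<^bsub>B\<^esub> one_tensor \<phi> A a"
  unfolding smult_one_tensor[OF assms] unfolding one_tensor_def
  using assms scaling_closed single_carrier
  by (intro coset_eqI) (auto simp: scalar_relations_def)

lemma one_tensor_add:
  assumes "a \<in> carrier A" "b \<in> carrier A"
  shows "one_tensor \<phi> A (a \<oplus> b) = one_tensor \<phi> A a \<oplus>\<^bsub>B\<^esub> one_tensor \<phi> A b"
proof -
  have ab: "Poly_Mapping.single a 1 + Poly_Mapping.single b (1::'k) \<in> carrier (monoid_algebra A)"
    using MA.a_closed[OF assms[THEN single_carrier]] by (simp add: monoid_algebra_simps)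
  have "one_tensor \<phi> A (a \<oplus> b) =
      relation_ideal +>\<^bsub>monoid_algebra A\<^esub> (Poly_Mapping.single a 1 + Poly_Mapping.single b 1)"
    unfolding one_tensor_def using assms single_carrier[OF a_closed[OF assms]] ab
    by (intro coset_eqI) (auto simp: scalar_relations_def)
  also have "\<dots> = one_tensor \<phi> A a \<oplus>\<^bsub>B\<^esub> one_tensor \<phi> A b"
    using assms by (simp add: one_tensor_def extend_scalars_def single_carrier
      quotient_algebra_add[OF relation_ideal]) (simp add: monoid_algebra_simps)
  finally show ?thesis .
qed

lemma extend_scalars_induct [consumes 1, case_names tensor add]:
  assumes "v \<in> carrier B"
    and tensor: "\<And>a c. a \<in> carrier A \<Longrightarrow> P (c \<odot>\<^bsub>B\<^esub> one_tensor \<phi> A a)"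
    and add: "\<And>v w. v \<in> carrier B \<Longrightarrow> w \<in> carrier B \<Longrightarrow> P v \<Longrightarrow> P w \<Longrightarrow> P (v \<oplus>\<^bsub>B\<^esub> w)"
  shows "P v"
proof -
  obtain f where f: "f \<in> carrier (monoid_algebra A)" "v = relation_ideal +>\<^bsub>monoid_algebra A\<^esub> f"
    using assms(1) by (auto simp: extend_scalars_def quotient_algebra_carrier)
  from f(1) have "P (relation_ideal +>\<^bsub>monoid_algebra A\<^esub> f)"
  proof (induction rule: monoid_algebra_induct)
    case zero
    then show ?case using tensor[of \<one> 0] smult_one_tensor[of \<one> 0] by simp
  next
    case (single a r)
    then show ?case using tensor[of a r] smult_one_tensor[of a r] by simp
  next
    case (add f g)
    then show ?case
      using assms(3)[of "relation_ideal +>\<^bsub>monoid_algebra A\<^esub> f" "relation_ideal +>\<^bsub>monoid_algebra A\<^esub> g"]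
        quotient_algebra_add[OF relation_ideal add.hyps]
      by (auto simp: extend_scalars_def quotient_algebra_carrier monoid_algebra_simps)
  qed
  then show ?thesis using f(2) by simp
qed

end

section \<open>The blob algebra as a blob monoid\<close>

text \<open>The parameter \<open>q'\<close> stands for the inverse of \<open>q\<close>.\<close>

locale blob_setting =
  fixes \<phi> :: "'r::comm_ring_1 \<Rightarrow> 'k::field" and n :: nat and q q' \<gamma> \<delta> :: 'r
  assumes \<phi>_one: "\<phi> 1 = 1"
begin

abbreviation "letters \<equiv> blob_gens n"
abbreviation "F \<equiv> monoid_algebra (free_monoid letters) :: ('r, _) module"
abbreviation "I \<equiv> Idl\<^bsub>F\<^esub> (blob_relations n q q' \<gamma> \<delta>)"
abbreviation "K \<equiv> blob_algebra_K n q q' \<gamma> \<delta>"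
abbreviation "B \<equiv> blob_algebra \<phi> n q q' \<gamma> \<delta>"
abbreviation "gen \<equiv> blob_generator \<phi> n q q' \<gamma> \<delta>"
abbreviation "val \<equiv> blob_word \<phi> n q q' \<gamma> \<delta>"
abbreviation "coset w r \<equiv> I +>\<^bsub>F\<^esub> Poly_Mapping.single w r"

lemma K_eq: "K = quotient_algebra F I"
  by (simp add: blob_algebra_K_def presented_algebra_def free_algebra_def)

sublocale F: ring F
  by (rule monoid_algebra_ring[OF free_monoid_monoid])

lemma relations_carrier: "blob_relations n q q' \<gamma> \<delta> \<subseteq> carrier F"
  using blob_relations_carrier by (simp add: free_algebra_def)

lemma I_ideal: "ideal I F"
  by (rule F.genideal_ideal[OF relations_carrier])

lemma single_closed: "w \<in> lists letters \<Longrightarrow> Poly_Mapping.single w r \<in> carrier F"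
  by (auto simp: monoid_algebra_simps free_monoid_def)

lemma coset_closed: "w \<in> lists letters \<Longrightarrow> coset w r \<in> carrier K"
  unfolding K_eq quotient_algebra_carrier using single_closed by blast

lemma coset_append:
  "v \<in> lists letters \<Longrightarrow> w \<in> lists letters \<Longrightarrow> coset (v @ w) 1 = coset v 1 \<otimes>\<^bsub>K\<^esub> coset w 1"
  unfolding K_eq
  by (simp add: single_closed quotient_algebra_mult[OF I_ideal])
    (simp add: monoid_algebra_simps convolution_single, simp add: free_monoid_def)

lemma coset_Nil: "coset [] 1 = \<one>\<^bsub>K\<^esub>"
  unfolding K_eq quotient_algebra_one by (simp add: monoid_algebra_simps free_monoid_def)

lemma smult_coset: "w \<in> lists letters \<Longrightarrow> r \<odot>\<^bsub>K\<^esub> coset w 1 = coset w r"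
  unfolding K_eq
  by (simp add: single_closed quotient_algebra_smult[OF free_monoid_monoid I_ideal])
    (simp add: monoid_algebra_simps map_times_single)

text \<open>A binomial in the relations identifies a word with a scalar multiple of another one; this is how all
relations of the blob algebra are used.\<close>

lemma coset_relation:
  assumes "v \<in> lists letters" "w \<in> lists letters"
    and "Poly_Mapping.single v 1 - Poly_Mapping.single w r \<in> blob_relations n q q' \<gamma> \<delta>"
  shows "coset v 1 = r \<odot>\<^bsub>K\<^esub> coset w 1"
proof -
  have "Poly_Mapping.single v 1 \<ominus>\<^bsub>F\<^esub> Poly_Mapping.single w r \<in> I"
    using assms single_closed F.genideal_self[OF relations_carrier]
    by (auto simp: monoid_algebra_minus[OF free_monoid_monoid])
  then show ?thesis
    using F.quotient_eq_iff_same_a_r_cos[OF I_ideal single_closed[OF assms(1)] single_closed[OF assms(2)]]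
      smult_coset[OF assms(2)] by simp
qed

sublocale ext: scalar_extension \<phi> K
  by (intro scalar_extension.intro scalar_extension_axioms.intro blob_algebra_K_ring
      blob_algebra_K_smult_closed)

lemma B_eq: "ext.B = B"
  by (simp add: blob_algebra_def)

sublocale B: scalar_ring B
  using ext.B.scalar_ring_axioms unfolding B_eq .

lemmas one_tensor_closed = ext.one_tensor_closed[unfolded B_eq]
  and one_tensor_one = ext.one_tensor_one[unfolded B_eq]
  and one_tensor_mult = ext.one_tensor_mult[unfolded B_eq]
  and one_tensor_smult = ext.one_tensor_smult[unfolded B_eq]
  and one_tensor_add = ext.one_tensor_add[unfolded B_eq]

lemmas B_induct [consumes 1, case_names tensor add] = ext.extend_scalars_induct[unfolded B_eq]

lemma gen_eq: "gen g = one_tensor \<phi> K (coset [g] 1)"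
  by (simp add: blob_generator_def presented_gen_def free_algebra_def)

lemma val_Nil [simp]: "val [] = \<one>\<^bsub>B\<^esub>"
  and val_Cons [simp]: "val (g # w) = gen g \<otimes>\<^bsub>B\<^esub> val w"
  by (simp_all add: blob_word_def word_value_def)

lemma gen_closed [simp]: "g \<in> letters \<Longrightarrow> gen g \<in> carrier B"
  unfolding gen_eq by (intro one_tensor_closed coset_closed) simp

lemma val_closed [simp]: "w \<in> lists letters \<Longrightarrow> val w \<in> carrier B"
  by (induction w) auto

lemma val_append:
  "v \<in> lists letters \<Longrightarrow> w \<in> lists letters \<Longrightarrow> val (v @ w) = val v \<otimes>\<^bsub>B\<^esub> val w"
  by (induction v) (auto simp: B.m_assoc)

lemma val_eq_one_tensor: "w \<in> lists letters \<Longrightarrow> val w = one_tensor \<phi> K (coset w 1)"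
proof (induction w)
  case Nil
  then show ?case by (simp add: coset_Nil one_tensor_one)
next
  case (Cons g w)
  then have "one_tensor \<phi> K (coset ([g] @ w) 1) = gen g \<otimes>\<^bsub>B\<^esub> val w"
    by (subst coset_append) (auto simp: one_tensor_mult coset_closed gen_eq)
  then show ?case by simp
qed

lemma val_relation:
  assumes "v \<in> lists letters" "w \<in> lists letters"
    and "Poly_Mapping.single v 1 - Poly_Mapping.single w r \<in> blob_relations n q q' \<gamma> \<delta>"
  shows "val v = (\<phi> r \<odot>\<^bsub>B\<^esub> \<one>\<^bsub>B\<^esub>) \<otimes>\<^bsub>B\<^esub> val w"
proof -
  have "val v = \<phi> r \<odot>\<^bsub>B\<^esub> val w"
    using assms(1,2) coset_relation[OF assms]
    by (simp add: val_eq_one_tensor one_tensor_smult coset_closed)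
  then show ?thesis using B.smult_eq_mult[of "val w"] assms(2) by simp
qed

lemma val_relation_1:
  assumes "v \<in> lists letters" "w \<in> lists letters"
    and "Poly_Mapping.single v 1 - Poly_Mapping.single w 1 \<in> blob_relations n q q' \<gamma> \<delta>"
  shows "val v = val w"
  using val_relation[OF assms] assms(2) by (simp add: \<phi>_one B.one_smult)

text \<open>The blob algebra is generated, under sums and scalars, by the words: an element of the extension of
scalars is a combination of elements \<open>1 \<otimes> a\<close>, and each \<open>a\<close> is a combination of words.\<close>

lemma B_word_induct [consumes 1, case_names word smult add]:
  assumes "v \<in> carrier B"
    and word: "\<And>w. w \<in> lists letters \<Longrightarrow> P (val w)"
    and smult: "\<And>c v. v \<in> carrier B \<Longrightarrow> P v \<Longrightarrow> P (c \<odot>\<^bsub>B\<^esub> v)"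
    and add: "\<And>v w. v \<in> carrier B \<Longrightarrow> w \<in> carrier B \<Longrightarrow> P v \<Longrightarrow> P w \<Longrightarrow> P (v \<oplus>\<^bsub>B\<^esub> w)"
  shows "P v"
  using assms(1)
proof (induction rule: B_induct)
  case (tensor a c)
  then obtain f where f: "f \<in> carrier F" "a = I +>\<^bsub>F\<^esub> f"
    by (auto simp: K_eq quotient_algebra_carrier)
  from f(1) have "P (one_tensor \<phi> K (I +>\<^bsub>F\<^esub> f))"
  proof (induction rule: monoid_algebra_induct)
    case zero
    have "coset [] 0 = I +>\<^bsub>F\<^esub> 0" by simp
    then show ?case
      using smult[OF val_closed word, of "[]" "\<phi> 0"] one_tensor_smult[of "coset [] 1" 0] coset_closed[of "[]"]
        smult_coset[of "[]" 0] by (simp add: val_eq_one_tensor[of "[]", simplified])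
  next
    case (single w r)
    then have w: "w \<in> lists letters" by (simp add: free_monoid_def)
    then show ?case
      using smult[OF val_closed[OF w] word[OF w], of "\<phi> r"] one_tensor_smult[of "coset w 1" r]
        coset_closed[of w] smult_coset[of w r] by (simp add: val_eq_one_tensor)
  next
    case (add f g)
    have fg: "I +>\<^bsub>F\<^esub> f \<in> carrier K" "I +>\<^bsub>F\<^esub> g \<in> carrier K"
      using add.hyps by (auto simp: K_eq quotient_algebra_carrier)
    have "I +>\<^bsub>F\<^esub> (f + g) = (I +>\<^bsub>F\<^esub> f) \<oplus>\<^bsub>K\<^esub> (I +>\<^bsub>F\<^esub> g)"
      unfolding K_eq quotient_algebra_add[OF I_ideal add.hyps] by (simp add: monoid_algebra_simps)
    then show ?case
      using assms(4)[OF one_tensor_closed[OF fg(1)] one_tensor_closed[OF fg(2)]] add.IH fg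
      by (simp add: one_tensor_add)
  qed
  then show ?case using smult f tensor one_tensor_closed by simp
qed (rule add)

lemma left_ideal_from_generators:
  assumes Q: "additive_subgroup Q B"
    and smult: "\<And>c v. v \<in> Q \<Longrightarrow> c \<odot>\<^bsub>B\<^esub> v \<in> Q"
    and gens: "\<And>g v. g \<in> gen ` letters \<Longrightarrow> v \<in> Q \<Longrightarrow> g \<otimes>\<^bsub>B\<^esub> v \<in> Q"
  shows "left_ideal Q B"
  unfolding left_ideal_def
proof (intro conjI Q ballI)
  fix a x assume "a \<in> carrier B" "x \<in> Q"
  then show "a \<otimes>\<^bsub>B\<^esub> x \<in> Q"
  proof (induction a arbitrary: x rule: B_word_induct)
    case (word w)
    then show ?case
    proof (induction w)
      case Nil
      then show ?case using additive_subgroup.a_Hcarr[OF Q] by simp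
    next
      case (Cons g w)
      then show ?case
        using gens[of "gen g" "val w \<otimes>\<^bsub>B\<^esub> x"] additive_subgroup.a_Hcarr[OF Q]
        by (simp add: B.m_assoc)
    qed
  next
    case (smult c v)
    then show ?case using additive_subgroup.a_Hcarr[OF Q] assms(2) by (simp add: B.smult_mult)
  next
    case (add v w)
    then show ?case
      using additive_subgroup.a_Hcarr[OF Q] additive_subgroup.a_closed[OF Q] by (simp add: B.l_distr)
  qed
qed

text \<open>Outside the range of indices, \<open>blob_generator\<close> applied to \<open>U i\<close> need not be an element of the algebra,
and is replaced by \<open>\<one>\<close>.\<close>

definition u :: "nat \<Rightarrow> _" where
  "u i = (if i \<in> {1..<n} then gen (U i) else \<one>\<^bsub>B\<^esub>)"

lemma E_letter [simp]: "E \<in> letters" and U_letter [simp]: "U i \<in> letters \<longleftrightarrow> i \<in> {1..<n}"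
  by (auto simp: blob_gens_def)

lemma u_gen [simp]: "i \<in> {1..<n} \<Longrightarrow> gen (U i) = u i"
  by (simp add: u_def)

lemma u_closed': "u i \<in> carrier B"
  using gen_closed[of "U i"] by (auto simp: u_def simp del: u_gen)

sublocale blob_generators B n "gen E" u "range (\<lambda>c. c \<odot>\<^bsub>B\<^esub> \<one>\<^bsub>B\<^esub>)"
  "\<phi> (q + q') \<odot>\<^bsub>B\<^esub> \<one>\<^bsub>B\<^esub>" "\<phi> \<gamma> \<odot>\<^bsub>B\<^esub> \<one>\<^bsub>B\<^esub>" "\<phi> \<delta> \<odot>\<^bsub>B\<^esub> \<one>\<^bsub>B\<^esub>"
proof unfold_locales
  show "\<one>\<^bsub>B\<^esub> \<in> range (\<lambda>c. c \<odot>\<^bsub>B\<^esub> \<one>\<^bsub>B\<^esub>)"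
    using B.one_smult by (metis rangeI)
  show "u i \<otimes>\<^bsub>B\<^esub> u i = (\<phi> (q + q') \<odot>\<^bsub>B\<^esub> \<one>\<^bsub>B\<^esub>) \<otimes>\<^bsub>B\<^esub> u i" if "1 \<le> i" "i < n" for i
    using that val_relation[OF _ _ blob_relations.U_square[of i n]] u_closed' by simp
  show "u i \<otimes>\<^bsub>B\<^esub> (u (Suc i) \<otimes>\<^bsub>B\<^esub> u i) = u i" if "1 \<le> i" "Suc i < n" for i
    using that val_relation_1[OF _ _ blob_relations.U_braid[of i n "Suc i"]] u_closed' by simp
  show "u (Suc i) \<otimes>\<^bsub>B\<^esub> (u i \<otimes>\<^bsub>B\<^esub> u (Suc i)) = u (Suc i)" if "1 \<le> i" "Suc i < n" for i
    using that val_relation_1[OF _ _ blob_relations.U_braid[of "Suc i" n i]] u_closed' by simp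
  show "u k \<otimes>\<^bsub>B\<^esub> u i = u i \<otimes>\<^bsub>B\<^esub> u k" if "1 \<le> i" "i + 2 \<le> k" "k < n" for i k
    using that val_relation_1[OF _ _ blob_relations.U_commute[of k n i]] u_closed' by simp
  show "u 1 \<otimes>\<^bsub>B\<^esub> (gen E \<otimes>\<^bsub>B\<^esub> u 1) = (\<phi> \<gamma> \<odot>\<^bsub>B\<^esub> \<one>\<^bsub>B\<^esub>) \<otimes>\<^bsub>B\<^esub> u 1" if "1 < n"
    using that val_relation[OF _ _ blob_relations.U_E_U[of n]] u_closed' by simp
  show "gen E \<otimes>\<^bsub>B\<^esub> gen E = (\<phi> \<delta> \<odot>\<^bsub>B\<^esub> \<one>\<^bsub>B\<^esub>) \<otimes>\<^bsub>B\<^esub> gen E"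
    using val_relation[OF _ _ blob_relations.E_square[of \<delta> n]] by simp
  show "u k \<otimes>\<^bsub>B\<^esub> gen E = gen E \<otimes>\<^bsub>B\<^esub> u k" if "2 \<le> k" "k < n" for k
    using that val_relation_1[OF _ _ blob_relations.U_E_commute[of k n]] u_closed' by simp
qed (use u_closed' B.scalar_central in auto)

end

section \<open>Walks of the Pascal triangle\<close>

definition weight :: "bool \<Rightarrow> nat \<Rightarrow> int" where
  "weight b a = (if b then int a else - int a)"

lemma walks_0: "walks 0 l = (if l = 0 then {[0]} else {})"
  by (auto simp: walks_def length_Suc_conv)

lemma walks_snocI:
  assumes "p \<in> walks j l" and "l' = l + 1 \<or> l' = l - 1"
  shows "p @ [l'] \<in> walks (Suc j) l'"
  using assms by (auto simp: walks_def nth_append less_Suc_eq)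

lemma walks_snocE:
  assumes "p \<in> walks (Suc j) l'"
  obtains p0 l where "p = p0 @ [l']" "p0 \<in> walks j l" "l' = l + 1 \<or> l' = l - 1"
proof
  from assms have len: "length p = Suc (Suc j)" by (simp add: walks_def)
  show p: "p = take (Suc j) p @ [l']"
    using assms take_Suc_conv_app_nth[of "Suc j" p] by (simp add: walks_def)
  show "take (Suc j) p \<in> walks j (p ! j)" "l' = p ! j + 1 \<or> l' = p ! j - 1"
    using assms by (auto simp: walks_def)
qed

lemma walk_word_snoc:
  assumes "p \<in> walks j l"
  shows "walk_word (Suc j) (p @ [l']) = walk_word j p @ edge_word j l l'"
proof -
  let ?q = "p @ [l']"
  have "map (\<lambda>i. edge_word i (?q ! i) (?q ! Suc i)) [0..<j] =
      map (\<lambda>i. edge_word i (p ! i) (p ! Suc i)) [0..<j]"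
    using assms by (auto simp: walks_def nth_append)
  then have "walk_word (Suc j) ?q = walk_word j p @ edge_word j (?q ! j) (?q ! Suc j)"
    unfolding walk_word_def by (simp only: upt_Suc_append map_append concat_append) simp
  then show ?thesis using assms by (simp add: walks_def nth_append)
qed

context blob_setting
begin

lemma val_U_descending: "s < n \<Longrightarrow> val (map U (rev [1..<Suc s])) = T s"
  by (induction s) auto

lemma val_E_word: "2 * c \<le> n \<Longrightarrow> val (map (\<lambda>i. U (2 * i + 1)) [0..<c]) = Cups c"
proof (induction c)
  case (Suc c)
  have "map (\<lambda>i. U (2 * i + 1)) [0..<c] \<in> lists letters"
    using Suc.prems by auto
  then show ?case using Suc by (simp add: val_append u_closed')
qed simp

lemma u_val_commute:
  assumes "k < n" "\<And>g. g \<in> set w \<Longrightarrow> \<exists>i. g = U i \<and> 1 \<le> i \<and> i + 2 \<le> k"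
  shows "u k \<otimes>\<^bsub>B\<^esub> val w = val w \<otimes>\<^bsub>B\<^esub> u k"
  using assms(2)
proof (induction w)
  case (Cons g w)
  obtain i where i: "g = U i" "1 \<le> i" "i + 2 \<le> k" using Cons.prems by auto
  have w: "w \<in> lists letters" using Cons.prems \<open>k < n\<close> by fastforce
  have "u k \<otimes>\<^bsub>B\<^esub> val w = val w \<otimes>\<^bsub>B\<^esub> u k" using Cons by simp
  then show ?case
    using i w \<open>k < n\<close> u_far_assoc[of i k "val w"] by (simp add: u_closed' B.m_assoc)
qed (simp add: u_closed')

text \<open>The new letters \<open>U\<^bsub>2c+2\<^esub>\<close> and \<open>U\<^bsub>2c+1\<^esub>\<close> move to the right end: they are far from the other letters
that they pass.\<close>

lemma val_decoration:
  "2 * c < n \<Longrightarrow> val (E # map (\<lambda>i. U (2 * i)) (rev [1..<Suc c]) @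
      map (\<lambda>i. U (2 * i - 1)) (rev [1..<Suc c])) = D c"
proof (induction c)
  case (Suc c)
  let ?even = "map (\<lambda>i. U (2 * i)) (rev [1..<Suc c])"
    and ?odd = "map (\<lambda>i. U (2 * i - 1)) (rev [1..<Suc c])"
    and ?a = "u (2 * c + 1)" and ?b = "u (2 * c + 2)"
  have letters: "?even \<in> lists letters" "?odd \<in> lists letters"
    using Suc.prems by (auto; arith)+
  have even: "?b \<otimes>\<^bsub>B\<^esub> val ?even = val ?even \<otimes>\<^bsub>B\<^esub> ?b"
    using Suc.prems by (intro u_val_commute) auto
  have odd: "k = 2 * c + 1 \<or> k = 2 * c + 2 \<Longrightarrow> u k \<otimes>\<^bsub>B\<^esub> val ?odd = val ?odd \<otimes>\<^bsub>B\<^esub> u k" for k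
  proof (rule u_val_commute)
    assume k: "k = 2 * c + 1 \<or> k = 2 * c + 2"
    then show "k < n" using Suc.prems by auto
    fix g assume "g \<in> set ?odd"
    then obtain i where "1 \<le> i" "i \<le> c" "g = U (2 * i - 1)" by auto
    then show "\<exists>i. g = U i \<and> 1 \<le> i \<and> i + 2 \<le> k"
      using k by (intro exI[of _ "2 * i - 1"]) auto
  qed
  have "val (E # map (\<lambda>i. U (2 * i)) (rev [1..<Suc (Suc c)]) @
      map (\<lambda>i. U (2 * i - 1)) (rev [1..<Suc (Suc c)])) =
      val (E # U (2 * c + 2) # ?even @ U (2 * c + 1) # ?odd)"
    by simp
  also have "\<dots> = gen E \<otimes>\<^bsub>B\<^esub> ((?b \<otimes>\<^bsub>B\<^esub> val ?even) \<otimes>\<^bsub>B\<^esub> (?a \<otimes>\<^bsub>B\<^esub> val ?odd))"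
    using Suc.prems letters by (simp add: val_append B.m_assoc u_closed' del: upt_Suc)
  also have "\<dots> = (gen E \<otimes>\<^bsub>B\<^esub> (val ?even \<otimes>\<^bsub>B\<^esub> ((?b \<otimes>\<^bsub>B\<^esub> val ?odd) \<otimes>\<^bsub>B\<^esub> ?a)))"
    unfolding even using odd[of "2 * c + 1"] letters
    by (simp add: B.m_assoc u_closed' del: upt_Suc)
  also have "?b \<otimes>\<^bsub>B\<^esub> val ?odd = val ?odd \<otimes>\<^bsub>B\<^esub> ?b"
    by (rule odd) simp
  also have "gen E \<otimes>\<^bsub>B\<^esub> (val ?even \<otimes>\<^bsub>B\<^esub> ((val ?odd \<otimes>\<^bsub>B\<^esub> ?b) \<otimes>\<^bsub>B\<^esub> ?a)) =
      (gen E \<otimes>\<^bsub>B\<^esub> (val ?even \<otimes>\<^bsub>B\<^esub> val ?odd)) \<otimes>\<^bsub>B\<^esub> (?b \<otimes>\<^bsub>B\<^esub> ?a)"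
    using letters by (simp add: B.m_assoc u_closed' del: upt_Suc)
  also have "gen E \<otimes>\<^bsub>B\<^esub> (val ?even \<otimes>\<^bsub>B\<^esub> val ?odd) = D c"
    using Suc letters by (simp add: val_append del: upt_Suc)
  finally show ?case by simp
qed simp

lemma val_edge:
  assumes "j < n"
  shows "l \<noteq> 0 \<Longrightarrow> \<bar>l'\<bar> = \<bar>l\<bar> - 1 \<Longrightarrow> val (edge_word j l l') = T j"
    and "j = 2 * c \<Longrightarrow> val (edge_word j 0 1) = D c"
    and "\<bar>l'\<bar> = \<bar>l\<bar> + 1 \<Longrightarrow> \<not> (l = 0 \<and> l' = 1) \<Longrightarrow> val (edge_word j l l') = \<one>\<^bsub>B\<^esub>"
  using assms val_U_descending[of j] val_decoration[of c]
  by (auto simp: edge_word_def simp del: upt_Suc)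

lemma edge_word_letters: "j < n \<Longrightarrow> edge_word j l l' \<in> lists letters"
  by (auto simp: edge_word_def; arith)

lemma walk_word_letters: "j \<le> n \<Longrightarrow> walk_word j p \<in> lists letters"
  by (force simp: walk_word_def in_lists_conv_set
      dest: edge_word_letters[unfolded in_lists_conv_set, THEN bspec, rotated])

lemma val_walk_snoc:
  "p \<in> walks j l \<Longrightarrow> j < n \<Longrightarrow>
    val (walk_word (Suc j) (p @ [l'])) = val (walk_word j p) \<otimes>\<^bsub>B\<^esub> val (edge_word j l l')"
  by (simp add: walk_word_snoc val_append walk_word_letters edge_word_letters)

text \<open>Each edge that leaves the vertex of a half-diagram corresponds to one rule of \<open>half\<close>.\<close>

lemma half_edge:
  assumes v: "half c b a v" and n: "2 * c + a < n"
    and l': "l' = weight b a + 1 \<or> l' = weight b a - 1"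
  shows "\<exists>c' b' a'. Suc (2 * c + a) = 2 * c' + a' \<and> l' = weight b' a' \<and>
    half c' b' a' (v \<otimes>\<^bsub>B\<^esub> val (edge_word (2 * c + a) (weight b a) l'))"
proof -
  have b: "b \<Longrightarrow> 0 < a" using half_decorated[OF v] by simp
  note vc = half_closed[OF v]
  consider (decorate) "a = 0" "l' = 1" | (away) "l' = weight b (Suc a)"
    | (toward) a' where "a = Suc a'" "l' = weight b a'"
    using l' b by (cases a; cases b) (force simp: weight_def)+
  then show ?thesis
  proof cases
    case decorate
    then have "\<not> b" using b by auto
    with decorate v have "half c True 1 (v \<otimes>\<^bsub>B\<^esub> D c)" using half.decorate[of c v] by simp
    then show ?thesis
      using val_edge(2)[OF n, of c] decorate \<open>\<not> b\<close>
      by (intro exI[of _ c] exI[of _ True] exI[of _ 1]) (simp add: weight_def)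
  next
    case away
    have "val (edge_word (2 * c + a) (weight b a) l') = \<one>\<^bsub>B\<^esub>"
      using away b by (intro val_edge(3)[OF n]) (auto simp: weight_def split: if_splits)
    then show ?thesis
      using half.away[OF v] away vc
      by (intro exI[of _ c] exI[of _ b] exI[of _ "Suc a"]) simp
  next
    case toward
    have "val (edge_word (2 * c + a) (weight b a) l') = T (2 * c + a' + 1)"
      using toward val_edge(1)[OF n, of "weight b a" l'] by (simp add: weight_def split: if_splits del: T.simps)
    moreover have "half (Suc c) (b \<and> 0 < a') a' (v \<otimes>\<^bsub>B\<^esub> T (2 * c + a' + 1))"
      using half.toward[of c b a' v] v toward by simp
    ultimately show ?thesis
      using toward
      by (intro exI[of _ "Suc c"] exI[of _ "b \<and> 0 < a'"] exI[of _ a']) (auto simp: weight_def)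
  qed
qed

lemma walk_half:
  "p \<in> walks j l \<Longrightarrow> j \<le> n \<Longrightarrow>
    \<exists>c b a. j = 2 * c + a \<and> l = weight b a \<and> half c b a (val (walk_word j p))"
proof (induction j arbitrary: p l)
  case 0
  then show ?case
    using half.start by (auto simp: walks_0 walk_word_def weight_def split: if_splits)
next
  case (Suc j)
  obtain p0 l0 where p: "p = p0 @ [l]" "p0 \<in> walks j l0" "l = l0 + 1 \<or> l = l0 - 1"
    using walks_snocE[OF Suc.prems(1)] by blast
  obtain c b a where h: "j = 2 * c + a" "l0 = weight b a" "half c b a (val (walk_word j p0))"
    using Suc.IH[OF p(2)] Suc.prems(2) by auto
  show ?case
    using half_edge[OF h(3), of l] p h(1,2) Suc.prems(2) val_walk_snoc[OF p(2), of l] by simp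
qed

lemma half_walk:
  "half c b a v \<Longrightarrow> 2 * c + a \<le> n \<Longrightarrow>
    \<exists>p\<in>walks (2 * c + a) (weight b a). v = val (walk_word (2 * c + a) p)"
proof (induction rule: half.induct)
  case start
  then show ?case by (simp add: walks_0 weight_def walk_word_def)
next
  case (away c b a v)
  then obtain p where p: "p \<in> walks (2 * c + a) (weight b a)" "v = val (walk_word (2 * c + a) p)"
    by auto
  have "val (edge_word (2 * c + a) (weight b a) (weight b (Suc a))) = \<one>\<^bsub>B\<^esub>"
    using away.prems half_decorated[OF away.hyps]
    by (intro val_edge(3)) (auto simp: weight_def split: if_splits)
  then have "v = val (walk_word (2 * c + Suc a) (p @ [weight b (Suc a)]))"
    using val_walk_snoc[OF p(1), of "weight b (Suc a)"] p(2) away.prems half_closed[OF away.hyps]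
    by simp
  moreover have "p @ [weight b (Suc a)] \<in> walks (2 * c + Suc a) (weight b (Suc a))"
    using walks_snocI[OF p(1)] by (auto simp: weight_def)
  ultimately show ?case by blast
next
  case (decorate c v)
  then obtain p where p: "p \<in> walks (2 * c) 0" "v = val (walk_word (2 * c) p)"
    by (auto simp: weight_def)
  have "v \<otimes>\<^bsub>B\<^esub> D c = val (walk_word (2 * c + 1) (p @ [1]))"
    using val_walk_snoc[OF p(1), of 1] p(2) decorate.prems val_edge(2)[of "2 * c" c] by simp
  moreover have "p @ [1] \<in> walks (2 * c + 1) (weight True 1)"
    using walks_snocI[OF p(1)] by (auto simp: weight_def)
  ultimately show ?case by blast
next
  case (toward c b a v)
  then obtain p where p: "p \<in> walks (2 * c + Suc a) (weight b (Suc a))"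
    "v = val (walk_word (2 * c + Suc a) p)" by auto
  have j: "Suc (2 * c + Suc a) = 2 * Suc c + a" by simp
  have w: "weight (b \<and> 0 < a) a = weight b a" by (simp add: weight_def)
  have "val (edge_word (2 * c + Suc a) (weight b (Suc a)) (weight b a)) = T (2 * c + a + 1)"
    using toward.prems by (subst val_edge(1)) (auto simp: weight_def)
  then have "v \<otimes>\<^bsub>B\<^esub> T (2 * c + a + 1) = val (walk_word (2 * Suc c + a) (p @ [weight b a]))"
    using val_walk_snoc[OF p(1), of "weight b a"] p(2) toward.prems by (simp del: T.simps)
  moreover have "p @ [weight b a] \<in> walks (2 * Suc c + a) (weight (b \<and> 0 < a) a)"
    using walks_snocI[OF p(1), of "weight b a"] unfolding j w by (auto simp: weight_def)
  ultimately show ?case by blast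
qed

abbreviation "S \<equiv> walk_elements \<phi> n q q' \<gamma> \<delta>"

lemma walk_elements_iff:
  "v \<in> S m \<longleftrightarrow> (\<exists>c b a. n = 2 * c + a \<and> m = weight b a \<and> half c b a v)"
proof
  assume "v \<in> S m"
  then show "\<exists>c b a. n = 2 * c + a \<and> m = weight b a \<and> half c b a v"
    using walk_half[of _ n m] by (auto simp: walk_elements_def)
next
  assume "\<exists>c b a. n = 2 * c + a \<and> m = weight b a \<and> half c b a v"
  then show "v \<in> S m"
    using half_walk by (fastforce simp: walk_elements_def)
qed

lemma walk_elements_carrier: "S m \<subseteq> carrier B"
  unfolding subset_iff walk_elements_iff using half_closed by blast

lemma E_word_carrier: "val (E_word l n) \<in> carrier B"
proof -
  have "2 * ((n - l) div 2) \<le> n" by presburger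
  then show ?thesis using val_E_word by (simp add: E_word_def)
qed

lemma generator_mult_walk_element:
  assumes "1 \<le> n" and s: "s \<in> S m" and g: "g \<in> gen ` letters"
  shows "g \<otimes>\<^bsub>B\<^esub> s \<in> lin_span B (S m) \<or> (m < 0 \<and> g \<otimes>\<^bsub>B\<^esub> s \<in> S (- m)) \<or>
    (2 \<le> \<bar>m\<bar> \<and> g \<otimes>\<^bsub>B\<^esub> s \<in> Idl\<^bsub>B\<^esub> {val (E_word (nat (\<bar>m\<bar> - 2)) n)})"
proof -
  obtain c b a where h: "n = 2 * c + a" "m = weight b a" "half c b a s"
    using s unfolding walk_elements_iff by blast
  consider "g = gen E" | i where "1 \<le> i" "i < n" "g = u i"
    using g by (auto simp: blob_gens_def)
  then have str: "straightens c b a (g \<otimes>\<^bsub>B\<^esub> s)"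
    using h(1) u_half[OF h(3)] e_half[OF h(3)] assms(1) by cases simp_all
  have "2 * c + a \<le> n" using h(1) by simp
  from str this show ?thesis
  proof (cases rule: straightens_cases)
    case (scalar z v)
    then obtain k where "g \<otimes>\<^bsub>B\<^esub> s = k \<odot>\<^bsub>B\<^esub> v"
      using B.smult_eq_mult[OF half_closed[OF scalar(2)]] by auto
    moreover have "v \<in> S m"
      unfolding walk_elements_iff using scalar(2) h(1,2) by blast
    then have "v \<in> lin_span B (S m)"
      using B.lin_span_superset by blast
    ultimately show ?thesis
      using B.submodule_lin_span[OF walk_elements_carrier] by (auto simp: B.submodule_iff)
  next
    case flip
    then have "m < 0" "- m = weight True a" using h(2) by (auto simp: weight_def)
    then show ?thesis unfolding walk_elements_iff using flip h(1) by blast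
  next
    case (cups y y')
    have a: "nat (\<bar>m\<bar> - 2) = a - 2" using h(2) cups(1) by (auto simp: weight_def)
    have "(n - (a - 2)) div 2 = Suc c" using h(1) cups(1) by simp
    then have E: "val (E_word (nat (\<bar>m\<bar> - 2)) n) = Cups (Suc c)"
      using val_E_word[of "Suc c"] h(1) cups(1) unfolding a E_word_def by (simp del: Cups.simps)
    have I: "ideal (Idl\<^bsub>B\<^esub> {Cups (Suc c)}) B"
      by (intro B.genideal_ideal) (simp del: Cups.simps)
    have "g \<otimes>\<^bsub>B\<^esub> s \<in> Idl\<^bsub>B\<^esub> {Cups (Suc c)}"
      unfolding cups(4) using cups(2,3)
      by (intro ideal.I_l_closed[OF I] ideal.I_r_closed[OF I] B.genideal_self') (simp_all del: Cups.simps)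
    then show ?thesis unfolding E using cups(1) h(2) by (auto simp: weight_def)
  qed
qed

text \<open>The common core of the four cases, which differ only in the left ideal \<open>J\<close> that absorbs the errors.\<close>

lemma left_ideal_span_add:
  assumes "1 \<le> n" and J: "left_ideal J B" and flip: "m < 0 \<Longrightarrow> S (- m) \<subseteq> J"
    and cups: "2 \<le> \<bar>m\<bar> \<Longrightarrow> Idl\<^bsub>B\<^esub> {val (E_word (nat (\<bar>m\<bar> - 2)) n)} \<subseteq> J"
  shows "left_ideal (lin_span B (S m) <+>\<^bsub>B\<^esub> J) B"
proof (rule B.left_ideal_lin_span_add[OF left_ideal_from_generators _ J walk_elements_carrier])
  have V: "additive_subgroup (lin_span B (S m)) B"
    using B.submodule_lin_span[OF walk_elements_carrier] by (simp add: B.submodule_iff)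
  have J': "additive_subgroup J B" using J by (simp add: left_ideal_def)
  fix g s assume "g \<in> gen ` letters" "s \<in> S m"
  then show "g \<otimes>\<^bsub>B\<^esub> s \<in> lin_span B (S m) <+>\<^bsub>B\<^esub> J"
    using generator_mult_walk_element[OF assms(1), of s m g] flip cups
      B.set_add_left[OF J' additive_subgroup.a_subset[OF V]]
      B.set_add_right[OF V additive_subgroup.a_subset[OF J']] by blast
qed auto

end

theorem proposition13:
  fixes \<phi> :: "'r::comm_ring_1 \<Rightarrow> 'k::field"
    and x x' \<gamma> \<delta> :: 'r
    and n :: nat and m :: int
  assumes \<phi>_hom: "\<phi> 1 = 1" "\<And>a b. \<phi> (a + b) = \<phi> a + \<phi> b" "\<And>a b. \<phi> (a * b) = \<phi> a * \<phi> b"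
    and x_inverse: "x * x' = 1"
    and n: "n \<ge> 1"
    and m: "\<bar>m\<bar> \<le> int n" "m mod 2 = int n mod 2"
  defines "B \<equiv> blob_algebra \<phi> n (x\<^sup>2) (x'\<^sup>2) \<gamma> \<delta>"
    and "S \<equiv> walk_elements \<phi> n (x\<^sup>2) (x'\<^sup>2) \<gamma> \<delta>"
    and "EE \<equiv> (\<lambda>l. blob_word \<phi> n (x\<^sup>2) (x'\<^sup>2) \<gamma> \<delta> (E_word (nat l) n))"
  shows "(m \<in> {0, 1} \<longrightarrow> lin_span B (S m) = left_ideal_gen B (S m)) \<and>
    (m = -1 \<longrightarrow> left_ideal (lin_span B (S m) <+>\<^bsub>B\<^esub> left_ideal_gen B (S 1)) B) \<and>
    (m \<ge> 2 \<longrightarrow> left_ideal (lin_span B (S m) <+>\<^bsub>B\<^esub> Idl\<^bsub>B\<^esub> {EE (m - 2)}) B) \<and>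
    (m < -1 \<longrightarrow>
      left_ideal (lin_span B (S m) <+>\<^bsub>B\<^esub>
        (left_ideal_gen B (S (- m)) <+>\<^bsub>B\<^esub> Idl\<^bsub>B\<^esub> {EE (\<bar>m\<bar> - 2)})) B)"
proof -
  interpret P: blob_setting \<phi> n "x\<^sup>2" "x'\<^sup>2" \<gamma> \<delta>
    by unfold_locales (rule \<phi>_hom)
  interpret R: scalar_ring B
    unfolding B_def by (rule P.B.scalar_ring_axioms)
  note span = P.left_ideal_span_add[OF n, folded B_def S_def]
  have S: "S l \<subseteq> carrier B" for l
    unfolding S_def B_def by (rule P.walk_elements_carrier)
  have gen: "left_ideal (left_ideal_gen B (S l)) B" for l
    by (rule R.left_ideal_left_ideal_gen[OF S])
  have "EE l \<in> carrier B" for l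
    unfolding EE_def B_def by (rule P.E_word_carrier)
  then have EE: "left_ideal (Idl\<^bsub>B\<^esub> {EE l}) B" for l
    by (intro R.ideal_left_ideal R.genideal_ideal) simp
  have "lin_span B (S m) = left_ideal_gen B (S m)" if "m \<in> {0, 1}"
  proof
    have V: "lin_span B (S m) \<subseteq> carrier B" "additive_subgroup (lin_span B (S m)) B"
      using R.submodule_lin_span[OF S, of m] additive_subgroup.a_subset[of "lin_span B (S m)" B]
      by (simp_all add: R.submodule_iff)
    \<comment> \<open>for weights 0 and 1 there are no error terms, and \<open>J\<close> is the zero ideal\<close>
    have "left_ideal (lin_span B (S m) <+>\<^bsub>B\<^esub> {\<zero>\<^bsub>B\<^esub>}) B"
      using that R.ideal_left_ideal[OF R.zeroideal] by (intro span) auto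
    moreover have "lin_span B (S m) <+>\<^bsub>B\<^esub> {\<zero>\<^bsub>B\<^esub>} = lin_span B (S m)"
      using V(1) by (force simp: R.set_add_iff)
    ultimately show "left_ideal_gen B (S m) \<subseteq> lin_span B (S m)"
      by (intro R.left_ideal_gen_minimal R.lin_span_superset) simp
    show "lin_span B (S m) \<subseteq> left_ideal_gen B (S m)"
      using gen R.left_ideal_smult[OF gen]
      by (intro R.lin_span_minimal R.left_ideal_gen_superset)
        (auto simp: R.submodule_iff left_ideal_def)
  qed
  moreover have "left_ideal (lin_span B (S m) <+>\<^bsub>B\<^esub> left_ideal_gen B (S 1)) B" if "m = -1"
    using that gen R.left_ideal_gen_superset by (intro span) auto
  moreover have "left_ideal (lin_span B (S m) <+>\<^bsub>B\<^esub> Idl\<^bsub>B\<^esub> {EE (m - 2)}) B" if "m \<ge> 2"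
    using that EE by (intro span) (auto simp: EE_def)
  moreover have "left_ideal (lin_span B (S m) <+>\<^bsub>B\<^esub>
      (left_ideal_gen B (S (- m)) <+>\<^bsub>B\<^esub> Idl\<^bsub>B\<^esub> {EE (\<bar>m\<bar> - 2)})) B" if "m < -1"
  proof (rule span)
    let ?J = "left_ideal_gen B (S (- m))" and ?I = "Idl\<^bsub>B\<^esub> {EE (\<bar>m\<bar> - 2)}"
    have sub: "additive_subgroup ?J B" "additive_subgroup ?I B" "?J \<subseteq> carrier B" "?I \<subseteq> carrier B"
      using gen EE R.left_ideal_carrier by (auto simp: left_ideal_def)
    show "left_ideal (?J <+>\<^bsub>B\<^esub> ?I) B"
      by (rule R.left_ideal_add[OF gen EE])
    show "S (- m) \<subseteq> ?J <+>\<^bsub>B\<^esub> ?I"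
      using R.left_ideal_gen_superset R.set_add_left[OF sub(2,3)] by blast
    show "Idl\<^bsub>B\<^esub> {blob_word \<phi> n (x\<^sup>2) (x'\<^sup>2) \<gamma> \<delta> (E_word (nat (\<bar>m\<bar> - 2)) n)} \<subseteq> ?J <+>\<^bsub>B\<^esub> ?I"
      using R.set_add_right[OF sub(1,4)] by (simp add: EE_def)
  qed
  ultimately show ?thesis by blast
qed

end
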